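(* For $c$ large, $$\left(\sqrt{c}\,\frac{\sqrt8-\sqrt1}{3\sqrt\pi}-O(1)\right)n \;\lesssim\; f(n,cn)-\tfrac34 cn \;\lesssim\; \left(\sqrt c\,\sqrt{3\ln(2)/8}\right)n .$$
   Context: A random 2-SAT formula $F(n,m)$ on variables $X_1,\dots,X_n$ consists of $m$ clauses, each chosen independently and uniformly at random (with replacement) from the $2^2\binom n2$ proper clauses (disjunctions of two literals on two distinct variables). $\max F$ is the maximum over truth assignments of the number of clauses satisfied, and $f(n,m)=\mathbb{E}[\max F(n,m)]$; $cn$ is understood as $\lfloor cn\rfloor$. Notation: $a(n)\lesssim b(n)$ means $\limsup_{n\to\infty} a(n)/b(n)\le 1$. In statements involving both $n$ and the parameter $c$, the limit in $n$ is taken first for fixed $c$: for any desired error bound there is $c_0$ such that for all $c>c_0$ the asymptotic (in $n$) statement holds, with the $O(1)$ term bounded independently of $c$. *)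

theory Defs
  imports "HOL-Probability.Probability"
begin

text \<open>A literal is a pair of a variable index and a sign: \<open>(i, True)\<close> is \<open>X\<^sub>i\<close> and
  \<open>(i, False)\<close> is its negation.  A clause is the (unordered) set of literals it disjoins.\<close>

type_synonym literal = "nat \<times> bool"
type_synonym clause = "literal set"
type_synonym assignment = "nat \<Rightarrow> bool"

definition proper_clauses :: "nat \<Rightarrow> clause set" where
  "proper_clauses n = {{(i, a), (j, b)} | i a j b. i \<in> {1..n} \<and> j \<in> {1..n} \<and> i \<noteq> j}"

text \<open>A formula is a list, since clauses are drawn with replacement and a repeated clause
  counts with its multiplicity.  For \<open>n < 2\<close> there are no proper clauses and
  \<open>random_2sat n m\<close> is a meaningless default.\<close>

definition random_2sat :: "nat \<Rightarrow> nat \<Rightarrow> clause list pmf" where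
  "random_2sat n m = replicate_pmf m (pmf_of_set (proper_clauses n))"

definition satisfies :: "assignment \<Rightarrow> clause \<Rightarrow> bool" where
  "satisfies \<sigma> C \<longleftrightarrow> (\<exists>(i, s) \<in> C. \<sigma> i = s)"

definition num_satisfied :: "assignment \<Rightarrow> clause list \<Rightarrow> nat" where
  "num_satisfied \<sigma> F = length (filter (satisfies \<sigma>) F)"

text \<open>Assignments are defined on all of \<open>nat\<close>; values on variables not occurring in the formula
  are irrelevant.  The maximum is over a nonempty finite set of numbers at most \<open>length F\<close>.\<close>

definition max_sat :: "clause list \<Rightarrow> nat" where
  "max_sat F = Max (range (\<lambda>\<sigma>. num_satisfied \<sigma> F))"

definition expected_max_sat :: "nat \<Rightarrow> nat \<Rightarrow> real" where
  "expected_max_sat n m = measure_pmf.expectation (random_2sat n m) (\<lambda>F. real (max_sat F))"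

text \<open>\<open>limsup a/b \<le> 1\<close> expresses an upper bound on \<open>a\<close> only where \<open>b\<close> is positive, so
  eventual positivity of the right-hand side is made part of the relation.\<close>

definition asymp_le :: "(nat \<Rightarrow> real) \<Rightarrow> (nat \<Rightarrow> real) \<Rightarrow> bool" (infix "\<lesssim>" 50) where
  "a \<lesssim> b \<longleftrightarrow> (\<forall>\<^sub>F n in sequentially. 0 < b n) \<and> limsup (\<lambda>n. ereal (a n / b n)) \<le> 1"

lemma card_proper_clauses: "card (proper_clauses n) = 2\<^sup>2 * (n choose 2)"
proof -
  let ?L = "{1..n} \<times> (UNIV :: bool set)"
  let ?D = "(\<lambda>i. {(i, True), (i, False)}) ` {1..n}"
  let ?S = "{C. C \<subseteq> ?L \<and> card C = 2}"
  have split: "?S = proper_clauses n \<union> ?D"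
  proof (intro equalityI subsetI)
    fix C assume "C \<in> ?S"
    then obtain i a j b where C: "C = {(i, a), (j, b)}" "(i, a) \<noteq> (j, b)" "i \<in> {1..n}" "j \<in> {1..n}"
      by (auto simp: card_2_iff)
    show "C \<in> proper_clauses n \<union> ?D"
    proof (cases "i = j")
      case True
      with C have "C = {(i, True), (i, False)}" by (cases a; cases b) auto
      with C show ?thesis by blast
    next
      case False
      with C show ?thesis unfolding proper_clauses_def by blast
    qed
  qed (auto simp: proper_clauses_def)
  have disj: "proper_clauses n \<inter> ?D = {}"
    by (auto simp: proper_clauses_def doubleton_eq_iff)
  have finS: "finite ?S" by (rule finite_subset[of _ "Pow ?L"]) auto
  have "card ?S = (2 * n) choose 2"
    by (subst n_subsets) (auto simp: card_cartesian_product mult.commute)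
  moreover have "card ?D = n"
    by (subst card_image) (auto simp: inj_on_def doubleton_eq_iff)
  moreover have "card ?S = card (proper_clauses n) + card ?D"
    using finS disj unfolding split by (intro card_Un_disjoint) auto
  ultimately have "card (proper_clauses n) + n = (2 * n) choose 2" by simp
  moreover have "(2 * n) choose 2 = 4 * (n choose 2) + n"
  proof (induction n)
    case (Suc n)
    have step: "Suc k choose 2 = k + (k choose 2)" for k
      using binomial_Suc_Suc[of k 1] by (simp add: numeral_2_eq_2)
    have "(2 * Suc n) choose 2 = Suc (2 * n) + (2 * n + ((2 * n) choose 2))"
      using step[of "Suc (2 * n)"] step[of "2 * n"] by simp
    then show ?case using Suc.IH step[of n] by linarith
  qed simp
  ultimately show ?thesis by simp
qed

end

theory Submission
  imports Defs
begin

text \<open>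
  Write assignments and literal signs as \<open>\<plusminus>1\<close>.  A clause on variables \<open>j < i\<close> with signs \<open>a, b\<close> is
  satisfied by \<open>x\<close> with indicator \<open>3/4 + (a x\<^sub>j + b x\<^sub>i - a b x\<^sub>j x\<^sub>i) / 4\<close>.

  Upper bound: the number of clauses satisfied by a fixed assignment is binomial with success
  probability \<open>3/4\<close>, whose upper tail is subgaussian with the true variance \<open>3/16\<close>; apply the
  exponential union bound over the \<open>2\<^sup>n\<close> assignments.

  Lower bound: set the variables in the order \<open>1, \<dots>, n\<close>, each time following the sign of the sum
  \<open>L\<^sub>i\<close> of the influences \<open>a\<close> (clauses where \<open>i\<close> is the smaller variable) and \<open>b (1 - a x\<^sub>j)\<close> (clauses
  where it is the larger one).  The excess over \<open>3/4 m\<close> is then \<open>\<Sum>\<^sub>i \<bar>L\<^sub>i\<bar> / 4\<close>.  The signs of \<open>i\<close> seen at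
  step \<open>i\<close> are independent of the earlier decisions, so \<open>L\<^sub>i\<close> is conditionally a Rademacher sum
  with coefficients in \<open>{0, \<plusminus>1, \<plusminus>2}\<close>, and \<open>E \<bar>L\<^sub>i\<bar> \<ge> E \<surd>(2 V\<^sub>i / \<pi>) - O(1)\<close> with \<open>V\<^sub>i\<close> the sum of their squares.
  Finally \<open>\<Sum>\<^sub>i \<bar>V\<^sub>i - \<mu>\<^sub>i\<bar>\<close> with \<open>\<mu>\<^sub>i \<approx> 2 c (1 + i / n)\<close> is \<open>O(\<surd>c n)\<close> in expectation, again by a
  union bound (over the assignment and the signs of the differences), and \<open>\<Sum>\<^sub>i \<surd>\<mu>\<^sub>i\<close> is a Riemann sum
  of \<open>\<surd>(1 + t)\<close> on \<open>[0, 1]\<close>.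
\<close>

section \<open>Mean absolute value of Rademacher sums\<close>

lemma gaussian_antiderivative:
  obtains G :: "real \<Rightarrow> real" where "G 0 = 0"
    and "\<And>y. 0 \<le> y \<Longrightarrow> (G has_real_derivative exp (- y\<^sup>2)) (at y)"
    and "(G \<longlongrightarrow> sqrt pi / 2) at_top"
proof -
  define g where "g = (\<lambda>s::real. exp (- s\<^sup>2))"
  \<comment> \<open>Integrating from -1 rather than from 0 makes 0 an interior point of the
    interval, so the derivative there is two-sided.\<close>
  define G where "G y = integral {-1..y} g - integral {-1..0} g" for y
  have cont: "continuous_on A g" for A
    unfolding g_def by (intro continuous_intros)
  then have int: "g integrable_on {a..b}" for a b
    by (rule integrable_continuous_interval)
  have "(G has_real_derivative exp (- y\<^sup>2)) (at y)" if "0 \<le> y" for y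
  proof -
    have "((\<lambda>x. integral {-1..x} g) has_real_derivative g y) (at y within {-1..y+1})"
      using that by (intro integral_has_real_derivative cont) auto
    then have "((\<lambda>x. integral {-1..x} g) has_real_derivative g y) (at y)"
      using that by (subst (asm) at_within_interior) auto
    then show ?thesis
      unfolding G_def by (auto intro!: derivative_eq_intros simp: g_def)
  qed
  moreover have "(G \<longlongrightarrow> sqrt pi / 2) at_top"
  proof -
    have "((\<lambda>y. \<integral>x. indicator {..y} x *\<^sub>R (indicator {0..} x *\<^sub>R g x) \<partial>lborel) \<longlongrightarrow> sqrt pi / 2) at_top"
      using tendsto_integral_at_top[of lborel "\<lambda>x. indicator {0..} x *\<^sub>R g x"] gaussian_moment_0
      unfolding has_bochner_integral_iff g_def by (metis sets_lborel)
    moreover have "(\<integral>x. indicator {..y} x *\<^sub>R (indicator {0..} x *\<^sub>R g x) \<partial>lborel) = G y" if "0 \<le> y" for y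
    proof -
      have "(\<integral>x. indicator {..y} x *\<^sub>R (indicator {0..} x *\<^sub>R g x) \<partial>lborel)
          = (LINT x:{0..y}|lborel. g x)"
        unfolding set_lebesgue_integral_def
        by (intro Bochner_Integration.integral_cong) (auto simp: indicator_def)
      also have "\<dots> = integral {0..y} g"
        by (intro set_borel_integral_eq_integral borel_integrable_atLeastAtMost' cont)
      also have "\<dots> = G y"
        using Henstock_Kurzweil_Integration.integral_combine[of "-1" 0 y g] int that by (simp add: G_def)
      finally show ?thesis .
    qed
    ultimately show ?thesis
      by (elim Lim_transform_eventually) (auto intro: eventually_mono[OF eventually_ge_at_top[of 0]])
  qed
  moreover have "G 0 = 0" by (simp add: G_def)
  ultimately show ?thesis using that by blast
qed

text \<open>The product \<open>cos v * exp (v\<^sup>2 / 2)\<close> equals 1 at 0 and decreases on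
  [0, 1], because its derivative has the sign of \<open>v * cos v - sin v\<close>. Evenness covers
  negative arguments.\<close>

lemma cos_le_exp_neg_square:
  fixes u :: real
  assumes "\<bar>u\<bar> \<le> 1"
  shows "cos u \<le> exp (- u\<^sup>2 / 2)"
proof -
  have *: "x * cos x \<le> sin x" if "0 \<le> x" "x \<le> 1" for x :: real
  proof -
    have "sin 0 - 0 * cos 0 \<le> sin x - x * cos x"
    proof (rule DERIV_nonneg_imp_nondecreasing[OF \<open>0 \<le> x\<close>])
      fix y :: real assume y: "0 \<le> y" "y \<le> x"
      then have "0 \<le> sin y" using that pi_gt3 by (intro sin_ge_zero) auto
      then show "\<exists>d. ((\<lambda>x. sin x - x * cos x) has_real_derivative d) (at y) \<and> 0 \<le> d"
        using y by (intro exI[of _ "y * sin y"]) (auto intro!: derivative_eq_intros)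
    qed
    then show ?thesis by simp
  qed
  have "cos v * exp (v\<^sup>2 / 2) \<le> cos 0 * exp (0\<^sup>2 / 2)" if "0 \<le> v" "v \<le> 1" for v :: real
  proof (rule DERIV_nonpos_imp_nonincreasing[OF \<open>0 \<le> v\<close>])
    fix x :: real assume x: "0 \<le> x" "x \<le> v"
    have "((\<lambda>v. cos v * exp (v\<^sup>2 / 2)) has_real_derivative
            exp (x\<^sup>2 / 2) * (x * cos x - sin x)) (at x)"
      by (auto intro!: derivative_eq_intros simp: algebra_simps)
    moreover have "exp (x\<^sup>2 / 2) * (x * cos x - sin x) \<le> 0"
      using *[of x] x that by (intro mult_nonneg_nonpos) auto
    ultimately show "\<exists>d. ((\<lambda>v. cos v * exp (v\<^sup>2 / 2)) has_real_derivative d) (at x) \<and> d \<le> 0"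
      by blast
  qed
  from this[of "\<bar>u\<bar>"] have "cos u * exp (u\<^sup>2 / 2) \<le> 1" using assms by simp
  then show ?thesis
    by (simp add: exp_minus field_simps)
qed

text \<open>Extensional functions make this a finite set, so a sum over \<open>signs K\<close> is
  \<open>2 ^ card K\<close> times an expectation over independent Rademacher variables.\<close>

definition signs :: "'a set \<Rightarrow> ('a \<Rightarrow> real) set" where
  "signs K = PiE K (\<lambda>_. {-1, 1})"

lemma finite_signs [simp]: "finite K \<Longrightarrow> finite (signs K)"
  unfolding signs_def by (intro finite_PiE) auto

lemma card_signs: "finite K \<Longrightarrow> card (signs K) = 2 ^ card K"
  unfolding signs_def by (simp add: card_PiE numeral_2_eq_2)

lemma sign_cases: "e \<in> signs K \<Longrightarrow> k \<in> K \<Longrightarrow> e k = -1 \<or> e k = 1"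
  by (auto simp: signs_def)

text \<open>This is the characteristic function of a Rademacher sum: \<open>cis\<close> turns the
  sum in the exponent into a product, which factorises over the independent signs, and the real part
  is taken at the end.\<close>

lemma sum_signs_cos:
  fixes c :: "'a \<Rightarrow> real"
  assumes "finite K"
  shows "(\<Sum>e\<in>signs K. cos (\<Sum>k\<in>K. c k * e k)) = 2 ^ card K * (\<Prod>k\<in>K. cos (c k))"
proof -
  have cis_sum: "cis (\<Sum>k\<in>K. f k) = (\<Prod>k\<in>K. cis (f k))" for f
    using assms by (induction K rule: finite_induct) (auto simp: cis_mult[symmetric])
  have "(\<Sum>e\<in>signs K. cis (\<Sum>k\<in>K. c k * e k)) = (\<Sum>e\<in>signs K. \<Prod>k\<in>K. cis (c k * e k))"
    by (simp add: cis_sum)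
  also have "\<dots> = (\<Prod>k\<in>K. \<Sum>s\<in>{-1, 1}. cis (c k * s))"
    unfolding signs_def using assms by (subst prod_sum_PiE) auto
  also have "\<dots> = (\<Prod>k\<in>K. complex_of_real (2 * cos (c k)))"
    by (intro prod.cong) (auto simp: complex_eq_iff)
  also have "\<dots> = complex_of_real (2 ^ card K * (\<Prod>k\<in>K. cos (c k)))"
    by (simp add: prod.distrib)
  finally have "Re (\<Sum>e\<in>signs K. cis (\<Sum>k\<in>K. c k * e k)) = 2 ^ card K * (\<Prod>k\<in>K. cos (c k))"
    by (simp only: Re_complex_of_real)
  then show ?thesis by simp
qed

section \<open>Truncated integral representations of the absolute value\<close>

lemma one_minus_cos_div_tendsto_0:
  "((\<lambda>t::real. (1 - cos (t * x)) / t) \<longlongrightarrow> 0) (at_right 0)"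
proof -
  have "((\<lambda>t::real. cos (t * x)) has_real_derivative 0) (at 0)"
    by (auto intro!: derivative_eq_intros)
  then have "((\<lambda>t. (cos (t * x) - 1) / t) \<longlongrightarrow> 0) (at 0)"
    by (simp add: has_field_derivative_iff)
  then have "((\<lambda>t. - ((cos (t * x) - 1) / t)) \<longlongrightarrow> - 0) (at 0)"
    by (rule tendsto_minus)
  then have "((\<lambda>t. (1 - cos (t * x)) / t) \<longlongrightarrow> 0) (at 0)"
    by (simp only: minus_divide_left minus_diff_eq minus_zero)
  then show ?thesis
    by (rule tendsto_mono[OF at_le[OF subset_UNIV]])
qed

text \<open>The truncated version of \<open>\<integral>\<^sub>0\<^sup>\<infinity> (1 - cos (t x)) / t\<^sup>2 dt = \<pi> \<bar>x\<bar> / 2\<close>, integrated by parts.\<close>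

definition abs_kernel :: "real \<Rightarrow> real \<Rightarrow> real" where
  "abs_kernel x t = x * Si (t * x) - (1 - cos (t * x)) / t"

lemma abs_kernel_deriv:
  assumes "t > 0"
  shows "(abs_kernel x has_real_derivative (1 - cos (t * x)) / t\<^sup>2) (at t)"
proof -
  have "((\<lambda>t. Si (t * x)) has_real_derivative sinc (t * x) * x) (at t)"
    by (rule DERIV_chain2[OF DERIV_Si]) (auto intro!: derivative_eq_intros)
  then have "((\<lambda>t. x * Si (t * x) - (1 - cos (t * x)) / t) has_real_derivative
      x * (sinc (t * x) * x) - (sin (t * x) * x * t - (1 - cos (t * x))) / (t * t)) (at t)"
    using assms by (auto intro!: derivative_eq_intros)
  moreover have "x * (sinc (t * x) * x) - (sin (t * x) * x * t - (1 - cos (t * x))) / (t * t)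
      = (1 - cos (t * x)) / t\<^sup>2"
    using assms by (cases "x = 0") (auto simp: field_simps power2_eq_square)
  ultimately show ?thesis
    unfolding abs_kernel_def[abs_def] by simp
qed

lemma abs_kernel_tendsto_0: "(abs_kernel x \<longlongrightarrow> 0) (at_right 0)"
proof -
  have "Si 0 = 0" using Si_neg[of 0] by simp
  have "((\<lambda>t. Si (t * x)) \<longlongrightarrow> Si (0 * x)) (at 0)"
    by (rule isCont_tendsto_compose[OF isCont_Si]) (intro tendsto_intros)
  then have "((\<lambda>t. Si (t * x)) \<longlongrightarrow> 0) (at 0)"
    using \<open>Si 0 = 0\<close> by simp
  then have "((\<lambda>t. Si (t * x)) \<longlongrightarrow> 0) (at_right 0)"
    by (rule tendsto_mono[OF at_le[OF subset_UNIV]])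
  from tendsto_diff[OF tendsto_mult_left[OF this, of x] one_minus_cos_div_tendsto_0[of x]]
  show ?thesis unfolding abs_kernel_def[abs_def] by simp
qed

text \<open>The integrand \<open>(1 - cos (t * x)) / t\<^sup>2\<close> is nonnegative, so the
  truncated integral increases with the cutoff. Its limit for positive \<open>x\<close> comes from
  \<open>Si\<close> tending to \<open>pi / 2\<close>, and the kernel is even in
  \<open>x\<close>.\<close>

lemma abs_kernel_le:
  assumes "T > 0"
  shows "abs_kernel x T \<le> pi / 2 * \<bar>x\<bar>"
proof -
  have pos: "abs_kernel x T \<le> pi / 2 * x" if "x > 0" for x
  proof (rule tendsto_lowerbound)
    show "\<forall>\<^sub>F t in at_top. abs_kernel x T \<le> abs_kernel x t"
      using eventually_ge_at_top[of T]
    proof eventually_elim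
      case (elim t)
      show ?case
        using assms by (intro DERIV_nonneg_imp_nondecreasing[OF elim])
          (force intro: abs_kernel_deriv)
    qed
    have "((\<lambda>t. Si (t * x)) \<longlongrightarrow> pi / 2) at_top"
      by (rule filterlim_compose[OF Si_at_top])
         (use that in \<open>auto intro!: filterlim_at_top_mult_tendsto_pos filterlim_ident tendsto_const\<close>)
    moreover have "((\<lambda>t. (1 - cos (t * x)) / t) \<longlongrightarrow> 0) at_top"
    proof (rule tendsto_0_le[where K = 2])
      show "((\<lambda>t::real. 1 / t) \<longlongrightarrow> 0) at_top"
        by (rule tendsto_divide_0[OF tendsto_const]) (simp add: filterlim_at_top_imp_at_infinity filterlim_ident)
      have "norm (1 - cos (t * x)) \<le> 2" for t
        using norm_triangle_ineq4[of 1 "cos (t * x)"] abs_cos_le_one[of "t * x"] by (auto simp del: abs_cos_le_one)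
      then show "\<forall>\<^sub>F t in at_top. norm ((1 - cos (t * x)) / t) \<le> norm (1 / t) * 2"
        by (intro always_eventually) (auto simp: divide_simps)
    qed
    ultimately have "((\<lambda>t. x * Si (t * x) - (1 - cos (t * x)) / t) \<longlongrightarrow> x * (pi / 2) - 0) at_top"
      by (intro tendsto_intros)
    then show "(abs_kernel x \<longlongrightarrow> pi / 2 * x) at_top"
      by (simp add: abs_kernel_def[abs_def] mult.commute)
  qed simp
  have neg: "abs_kernel (- x) T = abs_kernel x T"
  proof -
    have "Si (- y) = - Si y" for y
      by (cases "y \<ge> 0") (use Si_neg[of y] Si_neg[of "- y"] in auto)
    then show ?thesis by (simp add: abs_kernel_def)
  qed
  show ?thesis
  proof (cases x "0 :: real" rule: linorder_cases)
    case less
    then show ?thesis using pos[of "- x"] neg by simp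
  qed (use pos[of x] assms in \<open>auto simp: abs_kernel_def\<close>)
qed

text \<open>\<open>B\<close> is the truncated integral of \<open>abs_kernel\<close> with the cosine
  replaced by the characteristic function of a centred Gaussian of variance \<open>V\<close>. The
  full integral is \<open>sqrt (pi * V / 2)\<close>, and the part beyond \<open>t\<close> is at most
  the integral of \<open>1 / s\<^sup>2\<close>, that is \<open>1 / t\<close>.\<close>

lemma gaussian_kernel:
  fixes V :: real
  assumes "V > 0"
  obtains B :: "real \<Rightarrow> real" where
    "\<And>t. t > 0 \<Longrightarrow> (B has_real_derivative (1 - exp (- V * t\<^sup>2 / 2)) / t\<^sup>2) (at t)"
    "(B \<longlongrightarrow> 0) (at_right 0)"
    "\<And>t. t > 0 \<Longrightarrow> sqrt (pi * V / 2) - 1 / t \<le> B t"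
proof -
  obtain G :: "real \<Rightarrow> real" where G: "G 0 = 0"
    "\<And>y. 0 \<le> y \<Longrightarrow> (G has_real_derivative exp (- y\<^sup>2)) (at y)"
    "(G \<longlongrightarrow> sqrt pi / 2) at_top"
    using gaussian_antiderivative by blast
  define r where "r = sqrt (V / 2)"
  have r: "r > 0" "r\<^sup>2 = V / 2" using assms by (auto simp: r_def)
  define B where "B t = 2 * r * G (t * r) - (1 - exp (- V * t\<^sup>2 / 2)) / t" for t
  have G': "((\<lambda>t. G (t * r)) has_real_derivative exp (- V * t\<^sup>2 / 2) * r) (at t)" if "t \<ge> 0" for t
  proof -
    have "((\<lambda>t. G (t * r)) has_real_derivative exp (- (t * r)\<^sup>2) * r) (at t)"
      using that r by (intro DERIV_chain2[OF G(2)]) (auto intro!: derivative_eq_intros)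
    then show ?thesis by (simp add: power_mult_distrib r mult.commute)
  qed
  have B': "(B has_real_derivative (1 - exp (- V * t\<^sup>2 / 2)) / t\<^sup>2) (at t)" if "t > 0" for t
  proof -
    have "(B has_real_derivative 2 * r * (exp (- V * t\<^sup>2 / 2) * r)
        - (exp (- V * t\<^sup>2 / 2) * (V * t) * t - (1 - exp (- V * t\<^sup>2 / 2))) / (t * t)) (at t)"
      unfolding B_def[abs_def] using that G'[of t] by (auto intro!: derivative_eq_intros)
    moreover have "2 * r * (exp (- V * t\<^sup>2 / 2) * r) = V * exp (- V * t\<^sup>2 / 2)"
      using r(2) by (simp add: power2_eq_square algebra_simps)
    moreover have "V * E - (E * (V * t) * t - (1 - E)) / (t * t) = (1 - E) / t\<^sup>2" for E
      using that by (simp add: field_simps power2_eq_square)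
    ultimately show ?thesis by metis
  qed
  have "(B \<longlongrightarrow> 0) (at_right 0)"
  proof -
    have "((\<lambda>t. G (t * r)) \<longlongrightarrow> G (0 * r)) (at 0)"
      using DERIV_isCont[OF G'[of 0]] by (simp add: isCont_def)
    then have "((\<lambda>t. G (t * r)) \<longlongrightarrow> 0) (at 0)"
      using G(1) by simp
    then have 1: "((\<lambda>t. G (t * r)) \<longlongrightarrow> 0) (at_right 0)"
      by (rule tendsto_mono[OF at_le[OF subset_UNIV]])
    have "((\<lambda>t::real. exp (- V * t\<^sup>2 / 2)) has_real_derivative 0) (at 0)"
      by (auto intro!: derivative_eq_intros)
    then have "((\<lambda>t. (exp (- V * t\<^sup>2 / 2) - 1) / t) \<longlongrightarrow> 0) (at 0)"
      by (simp add: has_field_derivative_iff)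
    then have "((\<lambda>t. - ((exp (- V * t\<^sup>2 / 2) - 1) / t)) \<longlongrightarrow> - 0) (at 0)"
      by (rule tendsto_minus)
    then have "((\<lambda>t. (1 - exp (- V * t\<^sup>2 / 2)) / t) \<longlongrightarrow> 0) (at 0)"
      by (simp only: minus_divide_left minus_diff_eq minus_zero)
    then have 2: "((\<lambda>t. (1 - exp (- V * t\<^sup>2 / 2)) / t) \<longlongrightarrow> 0) (at_right 0)"
      by (rule tendsto_mono[OF at_le[OF subset_UNIV]])
    from tendsto_diff[OF tendsto_mult_left[OF 1, of "2 * r"] 2]
    show ?thesis unfolding B_def[abs_def] by simp
  qed
  moreover have "sqrt (pi * V / 2) - 1 / t \<le> B t" if "t > 0" for t
  proof -
    \<comment> \<open>Adding \<open>1 / t\<close> leaves a derivative that is a negative Gaussian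
      term, so the sum decreases to its limit at infinity.\<close>
    have "sqrt (pi * V / 2) \<le> B t + 1 / t"
    proof (rule tendsto_upperbound)
      show "\<forall>\<^sub>F s in at_top. B s + 1 / s \<le> B t + 1 / t"
        using eventually_ge_at_top[of t]
      proof eventually_elim
        case (elim s)
        show ?case
        proof (rule DERIV_nonpos_imp_nonincreasing[OF elim])
          fix x assume x: "t \<le> x" "x \<le> s"
          then have "((\<lambda>s. B s + 1 / s) has_real_derivative - exp (- V * x\<^sup>2 / 2) / x\<^sup>2) (at x)"
            using that B'[of x] by (auto intro!: derivative_eq_intros simp: field_simps power2_eq_square)
          then show "\<exists>d. ((\<lambda>s. B s + 1 / s) has_real_derivative d) (at x) \<and> d \<le> 0"
            by (intro exI conjI) auto
        qed
      qed
      have 1: "((\<lambda>s. G (s * r)) \<longlongrightarrow> sqrt pi / 2) at_top"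
        by (rule filterlim_compose[OF G(3)])
           (use r in \<open>auto intro!: filterlim_at_top_mult_tendsto_pos filterlim_ident tendsto_const\<close>)
      have 2: "((\<lambda>s. exp (- V * s\<^sup>2 / 2) / s) \<longlongrightarrow> 0) at_top"
      proof (rule tendsto_0_le[where K = 1])
        show "((\<lambda>t::real. 1 / t) \<longlongrightarrow> 0) at_top"
          by (rule tendsto_divide_0[OF tendsto_const]) (simp add: filterlim_at_top_imp_at_infinity filterlim_ident)
        have "exp (- V * s\<^sup>2 / 2) \<le> 1" for s using assms by simp
        then show "\<forall>\<^sub>F s in at_top. norm (exp (- V * s\<^sup>2 / 2) / s) \<le> norm (1 / s) * 1"
          by (intro always_eventually allI) (simp add: divide_right_mono)
      qed
      have "((\<lambda>s. 2 * r * G (s * r) + exp (- V * s\<^sup>2 / 2) / s) \<longlongrightarrow> 2 * r * (sqrt pi / 2) + 0) at_top"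
        by (intro tendsto_intros 1 2)
      moreover have "2 * r * (sqrt pi / 2) + 0 = sqrt (pi * V / 2)"
        by (simp add: r_def real_sqrt_mult real_sqrt_divide)
      moreover have "B s + 1 / s = 2 * r * G (s * r) + exp (- V * s\<^sup>2 / 2) / s" for s
        by (simp add: B_def diff_divide_distrib)
      ultimately show "((\<lambda>s. B s + 1 / s) \<longlongrightarrow> sqrt (pi * V / 2)) at_top" by simp
    qed simp
    then show ?thesis by simp
  qed
  ultimately show ?thesis using B' that by blast
qed

text \<open>The truncated kernel of the Rademacher sum is compared with that of a Gaussian of the
  same variance. A cutoff at 1/2 keeps every argument of a cosine in [-1, 1], where the cosine is
  nonnegative and below the Gaussian factor. The neglected Gaussian tail is at most 2, which after
  division by \<open>pi / 2\<close> is the loss \<open>4 / pi\<close>.\<close>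

lemma rademacher_abs_ge:
  fixes c :: "'a \<Rightarrow> real"
  assumes K: "finite K" and c: "\<And>k. k \<in> K \<Longrightarrow> \<bar>c k\<bar> \<le> 2"
  shows "2 ^ card K * (sqrt (2 / pi) * sqrt (\<Sum>k\<in>K. (c k)\<^sup>2) - 4 / pi)
    \<le> (\<Sum>e\<in>signs K. \<bar>\<Sum>k\<in>K. c k * e k\<bar>)"
proof (cases "(\<Sum>k\<in>K. (c k)\<^sup>2) = 0")
  case True
  have "2 ^ card K * (sqrt (2 / pi) * sqrt (\<Sum>k\<in>K. (c k)\<^sup>2) - 4 / pi) \<le> 0"
    unfolding True by (simp add: mult_le_0_iff)
  also have "\<dots> \<le> (\<Sum>e\<in>signs K. \<bar>\<Sum>k\<in>K. c k * e k\<bar>)" by (intro sum_nonneg) auto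
  finally show ?thesis .
next
  case False
  define V where "V = (\<Sum>k\<in>K. (c k)\<^sup>2)"
  have "V > 0" using False sum_nonneg[of K "\<lambda>k. (c k)\<^sup>2"] by (simp add: V_def order_less_le)
  then obtain B where B: "\<And>t. t > 0 \<Longrightarrow> (B has_real_derivative (1 - exp (- V * t\<^sup>2 / 2)) / t\<^sup>2) (at t)"
    "(B \<longlongrightarrow> 0) (at_right 0)" "\<And>t. t > 0 \<Longrightarrow> sqrt (pi * V / 2) - 1 / t \<le> B t"
    using gaussian_kernel by blast
  define N :: real where "N = 2 ^ card K"
  define L where "L e = (\<Sum>k\<in>K. c k * e k)" for e
  define D where "D t = (\<Sum>e\<in>signs K. abs_kernel (L e) t) - N * B t" for t
  \<comment> \<open>\<open>D\<close> tends to 0 at 0 from the right and is nondecreasing on the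
    interval up to 1/2; the derivative comparison uses the product formula for the averaged
    cosine.\<close>
  have "0 \<le> D (1 / 2)"
  proof (rule tendsto_upperbound[where F = "at_right 0"])
    have "(D \<longlongrightarrow> (\<Sum>e\<in>signs K. 0) - N * 0) (at_right 0)"
      unfolding D_def[abs_def] by (intro tendsto_intros B abs_kernel_tendsto_0)
    then show "(D \<longlongrightarrow> 0) (at_right 0)" by simp
    have "\<forall>\<^sub>F t in at_right (0::real). t < 1 / 2 \<and> 0 < t"
      by (auto simp: eventually_at_right[of 0 1] intro!: exI[of _ "1/2"])
    then show "\<forall>\<^sub>F t in at_right 0. D t \<le> D (1 / 2)"
    proof eventually_elim
      case (elim t)
      show ?case
      proof (rule DERIV_nonneg_imp_nondecreasing[where f = D])
        show "t \<le> 1 / 2" using elim by simp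
        fix x assume x: "t \<le> x" "x \<le> 1 / 2"
        then have "x > 0" using elim by simp
        have "(D has_real_derivative (\<Sum>e\<in>signs K. (1 - cos (x * L e)) / x\<^sup>2)
            - N * ((1 - exp (- V * x\<^sup>2 / 2)) / x\<^sup>2)) (at x)"
          unfolding D_def[abs_def]
          by (intro derivative_intros abs_kernel_deriv DERIV_cmult B \<open>x > 0\<close>)
        moreover have "0 \<le> (\<Sum>e\<in>signs K. (1 - cos (x * L e)) / x\<^sup>2)
            - N * ((1 - exp (- V * x\<^sup>2 / 2)) / x\<^sup>2)"
        proof -
          have "(\<Sum>e\<in>signs K. cos (x * L e)) = N * (\<Prod>k\<in>K. cos (x * c k))"
            using sum_signs_cos[OF K, of "\<lambda>k. x * c k"]
            by (simp add: L_def N_def sum_distrib_left mult.assoc)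
          also have "\<dots> \<le> N * (\<Prod>k\<in>K. exp (- (x * c k)\<^sup>2 / 2))"
          proof (intro mult_left_mono prod_mono conjI)
            fix k assume "k \<in> K"
            have "\<bar>x * c k\<bar> \<le> 1 / 2 * 2"
              unfolding abs_mult using x \<open>x > 0\<close> c[OF \<open>k \<in> K\<close>] by (intro mult_mono) auto
            then have *: "\<bar>x * c k\<bar> \<le> 1" by simp
            then show "cos (x * c k) \<le> exp (- (x * c k)\<^sup>2 / 2)" by (rule cos_le_exp_neg_square)
            show "0 \<le> cos (x * c k)" using * pi_gt3 by (intro cos_ge_zero) auto
          qed (simp add: N_def)
          also have "(\<Prod>k\<in>K. exp (- (x * c k)\<^sup>2 / 2)) = exp (- V * x\<^sup>2 / 2)"
            using K by (simp add: V_def exp_sum[symmetric] power_mult_distrib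
              sum_negf sum_divide_distrib[symmetric] sum_distrib_left[symmetric] mult.commute)
          finally have "(\<Sum>e\<in>signs K. cos (x * L e)) \<le> N * exp (- V * x\<^sup>2 / 2)" .
          moreover have "real (card (signs K)) = N" using K by (simp add: card_signs N_def)
          ultimately have "0 \<le> ((\<Sum>e\<in>signs K. 1 - cos (x * L e)) - N * (1 - exp (- V * x\<^sup>2 / 2))) / x\<^sup>2"
            by (simp add: sum_subtractf algebra_simps)
          then show ?thesis
            by (simp only: diff_divide_distrib[of "sum _ _"] sum_divide_distrib times_divide_eq_right)
        qed
        ultimately show "\<exists>d. (D has_real_derivative d) (at x) \<and> 0 \<le> d" by blast
      qed
    qed
  qed simp
  then have "N * (sqrt (pi * V / 2) - 2) \<le> (\<Sum>e\<in>signs K. abs_kernel (L e) (1 / 2))"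
    using B(3)[of "1/2"] by (intro order_trans[OF mult_left_mono[of "sqrt (pi * V / 2) - 2" "B (1/2)" N]])
      (simp_all add: D_def N_def)
  also have "\<dots> \<le> (\<Sum>e\<in>signs K. pi / 2 * \<bar>L e\<bar>)"
    by (intro sum_mono abs_kernel_le) auto
  finally have "2 / pi * (N * (sqrt (pi * V / 2) - 2)) \<le> (\<Sum>e\<in>signs K. \<bar>L e\<bar>)"
    by (simp only: sum_distrib_left[symmetric]) (simp add: field_simps)
  moreover have "2 / pi * (N * (sqrt (pi * V / 2) - 2)) = N * (2 / pi * sqrt (pi * V / 2) - 4 / pi)"
    by (simp add: algebra_simps)
  moreover have "2 / pi * sqrt (pi * V / 2) = sqrt (2 / pi) * sqrt V"
  proof -
    have "sqrt (2 / pi) * sqrt V = sqrt ((2 / pi)\<^sup>2 * (pi * V / 2))"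
      unfolding real_sqrt_mult[symmetric] by (simp add: power2_eq_square field_simps)
    also have "\<dots> = 2 / pi * sqrt (pi * V / 2)"
      by (subst real_sqrt_mult) simp
    finally show ?thesis by simp
  qed
  ultimately show ?thesis by (simp add: N_def V_def L_def)
qed

section \<open>Exponential union bounds\<close>

text \<open>For \<open>\<omega>\<close> uniform on the product, \<open>exp (t * Z \<omega>)\<close>
  is at most the sum over \<open>T\<close> of the exponentials, whose means factorise over
  \<open>K\<close>. Hence its mean is at most \<open>card T * exp (card K * s)\<close>, and Jensen's
  inequality bounds the mean of \<open>Z\<close>. The index \<open>\<tau>\<close> may depend on
  \<open>\<omega>\<close>, which is what permits choices adapted to the formula.\<close>

lemma sum_max_le_of_mgf:
  fixes h :: "'t \<Rightarrow> 'q \<Rightarrow> real"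
  assumes fin: "finite K" "finite Q" "Q \<noteq> {}" "finite T" "T \<noteq> {}" and "t > 0"
    and mgf: "\<And>\<tau>. \<tau> \<in> T \<Longrightarrow> (\<Sum>q\<in>Q. exp (t * h \<tau> q)) \<le> real (card Q) * exp s"
    and Z: "\<And>\<omega>. \<omega> \<in> PiE K (\<lambda>_. Q) \<Longrightarrow> \<exists>\<tau>\<in>T. Z \<omega> \<le> (\<Sum>k\<in>K. h \<tau> (\<omega> k))"
  shows "(\<Sum>\<omega>\<in>PiE K (\<lambda>_. Q). Z \<omega>)
    \<le> real (card Q) ^ card K * ((ln (real (card T)) + real (card K) * s) / t)"
proof -
  let ?\<Omega> = "PiE K (\<lambda>_. Q)"
  define N where "N = real (card Q) ^ card K"
  define u where "u = ln (real (card T)) + real (card K) * s"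
  have fin\<Omega>: "finite ?\<Omega>" using fin by (intro finite_PiE) auto
  have card\<Omega>: "real (card ?\<Omega>) = N" using fin by (simp add: card_PiE N_def)
  have T: "real (card T) > 0" using fin by (simp add: card_gt_0_iff)
  have "(\<Sum>\<omega>\<in>?\<Omega>. exp (t * Z \<omega>)) \<le> (\<Sum>\<omega>\<in>?\<Omega>. \<Sum>\<tau>\<in>T. \<Prod>k\<in>K. exp (t * h \<tau> (\<omega> k)))"
  proof (rule sum_mono)
    fix \<omega> assume "\<omega> \<in> ?\<Omega>"
    then obtain \<tau> where \<tau>: "\<tau> \<in> T" "Z \<omega> \<le> (\<Sum>k\<in>K. h \<tau> (\<omega> k))" using Z by blast
    have "exp (t * Z \<omega>) \<le> exp (t * (\<Sum>k\<in>K. h \<tau> (\<omega> k)))" using \<tau> \<open>t > 0\<close> by simp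
    also have "\<dots> = (\<Prod>k\<in>K. exp (t * h \<tau> (\<omega> k)))"
      using fin by (simp add: sum_distrib_left exp_sum)
    also have "\<dots> \<le> (\<Sum>\<tau>\<in>T. \<Prod>k\<in>K. exp (t * h \<tau> (\<omega> k)))"
      using fin \<tau> by (intro member_le_sum prod_nonneg) auto
    finally show "exp (t * Z \<omega>) \<le> (\<Sum>\<tau>\<in>T. \<Prod>k\<in>K. exp (t * h \<tau> (\<omega> k)))" .
  qed
  also have "\<dots> = (\<Sum>\<tau>\<in>T. \<Prod>k\<in>K. \<Sum>q\<in>Q. exp (t * h \<tau> q))"
    using fin by (subst sum.swap, intro sum.cong prod_sum_PiE[symmetric]) auto
  also have "\<dots> \<le> (\<Sum>\<tau>\<in>T. \<Prod>k\<in>K. real (card Q) * exp s)"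
    by (intro sum_mono prod_mono conjI mgf sum_nonneg) auto
  also have "\<dots> = N * exp u"
    using T by (simp add: N_def u_def exp_add exp_of_nat_mult power_mult_distrib)
  finally have le: "(\<Sum>\<omega>\<in>?\<Omega>. exp (t * Z \<omega>)) \<le> N * exp u" .
  \<comment> \<open>Jensen's inequality, through the tangent of \<open>exp\<close> at \<open>u\<close>.\<close>
  have "(\<Sum>\<omega>\<in>?\<Omega>. t * Z \<omega>) \<le> (\<Sum>\<omega>\<in>?\<Omega>. (u - 1) + exp (- u) * exp (t * Z \<omega>))"
  proof (rule sum_mono)
    fix \<omega>
    show "t * Z \<omega> \<le> u - 1 + exp (- u) * exp (t * Z \<omega>)"
      using exp_ge_add_one_self[of "t * Z \<omega> - u"] by (simp add: exp_diff exp_minus field_simps)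
  qed
  also have "\<dots> = N * (u - 1) + exp (- u) * (\<Sum>\<omega>\<in>?\<Omega>. exp (t * Z \<omega>))"
    by (simp add: sum.distrib sum_distrib_left card\<Omega>)
  also have "\<dots> \<le> N * (u - 1) + exp (- u) * (N * exp u)"
    using le by (intro add_left_mono mult_left_mono) auto
  also have "\<dots> = N * u" by (simp add: exp_minus algebra_simps)
  finally have "t * (\<Sum>\<omega>\<in>?\<Omega>. Z \<omega>) \<le> N * u" by (simp add: sum_distrib_left)
  then show ?thesis using \<open>t > 0\<close> by (simp add: N_def u_def field_simps)
qed

text \<open>\<open>3/32\<close> is half the variance of a Bernoulli variable with success probability \<open>3/4\<close>; the
  bound fails for \<open>t < 0\<close> near \<open>0\<close>.\<close>

lemma bernoulli_three_quarters_mgf: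
  fixes t :: real
  assumes "t \<ge> 0"
  shows "exp (- 3 * t / 4) + 3 * exp (t / 4) \<le> 4 * exp (3 * t\<^sup>2 / 32)"
proof -
  have *: "exp x * (4 - 3 * x) \<le> 4 + x" if "x \<ge> 0" for x :: real
  proof -
    have **: "exp y * (1 - 3 * y) \<le> 1" if "y \<ge> 0" for y :: real
    proof -
      have "1 - 3 * y \<le> exp (- y)"
        using exp_ge_add_one_self[of "- y"] that by linarith
      then show ?thesis by (simp add: exp_minus field_simps)
    qed
    have "exp x * (4 - 3 * x) - x \<le> exp 0 * (4 - 3 * 0) - 0"
    proof (rule DERIV_nonpos_imp_nonincreasing[OF that])
      fix y :: real assume "0 \<le> y" "y \<le> x"
      moreover have "((\<lambda>x. exp x * (4 - 3 * x) - x) has_real_derivative exp y * (1 - 3 * y) - 1) (at y)"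
        by (auto intro!: derivative_eq_intros simp: algebra_simps)
      ultimately show "\<exists>d. ((\<lambda>x. exp x * (4 - 3 * x) - x) has_real_derivative d) (at y) \<and> d \<le> 0"
        using ** by (intro exI conjI) auto
    qed
    then show ?thesis by simp
  qed
  \<comment> \<open>With \<open>exp (- 3 * t / 4)\<close> factored out and logarithms taken, both
    sides agree at 0, and the derivative of the difference has the sign of
    \<open>exp y * (4 - 3 * y) - (4 + y)\<close>.\<close>
  have "ln (1 + 3 * exp t) - 3 * t / 4 - 3 * t\<^sup>2 / 32 \<le> ln (1 + 3 * exp 0) - 3 * 0 / 4 - 3 * 0\<^sup>2 / 32"
  proof (rule DERIV_nonpos_imp_nonincreasing[OF assms])
    fix y :: real assume y: "0 \<le> y" "y \<le> t"
    have pos: "0 < 1 + 3 * exp y" by (intro add_pos_pos) auto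
    then have "((\<lambda>t. ln (1 + 3 * exp t) - 3 * t / 4 - 3 * t\<^sup>2 / 32) has_real_derivative
        3 * exp y / (1 + 3 * exp y) - 3 / 4 - 3 * y / 16) (at y)"
      by (auto intro!: derivative_eq_intros)
    moreover have "3 * exp y / (1 + 3 * exp y) - 3 / 4 - 3 * y / 16
        = 3 / 16 * (exp y * (4 - 3 * y) - (4 + y)) / (1 + 3 * exp y)"
      using pos by (simp add: divide_simps) (simp add: algebra_simps)
    moreover have "\<dots> \<le> 0"
      using *[OF y(1)] pos by (intro divide_nonpos_pos) auto
    ultimately show "\<exists>d. ((\<lambda>t. ln (1 + 3 * exp t) - 3 * t / 4 - 3 * t\<^sup>2 / 32) has_real_derivative d) (at y) \<and> d \<le> 0"
      by (intro exI conjI) auto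
  qed
  then have "ln (1 + 3 * exp t) \<le> ln 4 + (3 * t / 4 + 3 * t\<^sup>2 / 32)" by simp
  then have "exp (ln (1 + 3 * exp t)) \<le> exp (ln 4 + (3 * t / 4 + 3 * t\<^sup>2 / 32))" by simp
  moreover have "exp (ln (1 + 3 * exp t)) = 1 + 3 * exp t" by (intro exp_ln add_pos_pos) auto
  ultimately have "1 + 3 * exp t \<le> 4 * exp (3 * t / 4 + 3 * t\<^sup>2 / 32)" by (simp add: exp_add)
  then have "exp (- 3 * t / 4) * (1 + 3 * exp t) \<le> exp (- 3 * t / 4) * (4 * exp (3 * t / 4 + 3 * t\<^sup>2 / 32))"
    by (intro mult_left_mono) auto
  also have "\<dots> = 4 * exp (3 * t\<^sup>2 / 32)" by (simp add: mult_exp_exp algebra_simps)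
  also have "exp (- 3 * t / 4) * (1 + 3 * exp t) = exp (- 3 * t / 4) + 3 * exp (t / 4)"
    by (simp add: distrib_left mult_exp_exp algebra_simps)
  finally show ?thesis .
qed

text \<open>This rests on \<open>exp u \<le> 1 + u + u\<^sup>2\<close> for u in [-1, 1]; the linear
  terms cancel because \<open>h\<close> has mean zero.\<close>

lemma sum_exp_centered_le:
  fixes h :: "'q \<Rightarrow> real"
  assumes "finite Q" "sum h Q = 0" "\<And>q. q \<in> Q \<Longrightarrow> \<bar>h q\<bar> \<le> B" "0 \<le> t" "t * B \<le> 1"
  shows "(\<Sum>q\<in>Q. exp (t * h q)) \<le> real (card Q) * exp (t\<^sup>2 * B\<^sup>2)"
proof -
  have exp_le: "exp u \<le> 1 + u + u\<^sup>2" if "\<bar>u\<bar> \<le> 1" for u :: real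
  proof (cases "u \<ge> 0")
    case True
    then show ?thesis using that exp_bound[of u] by simp
  next
    case False
    \<comment> \<open>For negative \<open>u\<close> the inequality is proved in the form
      \<open>1 \<le> (1 + u + u\<^sup>2) * exp (- u)\<close>, using
      \<open>1 - u \<le> exp (- u)\<close>.\<close>
    have "(1 + u + u\<^sup>2) * (1 - u) = 1 - u * u\<^sup>2" by (simp add: algebra_simps power2_eq_square)
    moreover have "u * u\<^sup>2 \<le> 0" using False by (intro mult_nonpos_nonneg) auto
    ultimately have 1: "1 \<le> (1 + u + u\<^sup>2) * (1 - u)" by linarith
    have "0 \<le> (1 + u) + u\<^sup>2" using that zero_le_power2[of u] by linarith
    then have "(1 + u + u\<^sup>2) * (1 - u) \<le> (1 + u + u\<^sup>2) * exp (- u)"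
      using exp_ge_add_one_self[of "- u"] by (intro mult_left_mono) auto
    with 1 have "1 \<le> (1 + u + u\<^sup>2) * exp (- u)" by simp
    moreover have "exp u \<le> P" if "1 \<le> P * exp (- u)" for P
      using that by (simp add: exp_minus field_simps)
    ultimately show ?thesis by blast
  qed
  have "(\<Sum>q\<in>Q. exp (t * h q)) \<le> (\<Sum>q\<in>Q. 1 + t * h q + t\<^sup>2 * B\<^sup>2)"
  proof (rule sum_mono)
    fix q assume "q \<in> Q"
    then have "\<bar>t * h q\<bar> \<le> t * B" using assms by (simp add: abs_mult mult_left_mono)
    moreover from this have "(t * h q)\<^sup>2 \<le> (t * B)\<^sup>2" by (metis abs_ge_zero power2_abs power_mono)
    ultimately show "exp (t * h q) \<le> 1 + t * h q + t\<^sup>2 * B\<^sup>2"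
      using exp_le[of "t * h q"] assms by (simp add: power_mult_distrib)
  qed
  also have "\<dots> = real (card Q) * (1 + t\<^sup>2 * B\<^sup>2)"
    using assms(2) by (simp add: sum.distrib sum_distrib_left[symmetric] distrib_left)
  also have "\<dots> \<le> real (card Q) * exp (t\<^sup>2 * B\<^sup>2)"
    by (intro mult_left_mono exp_ge_add_one_self) auto
  finally show ?thesis .
qed

section \<open>Random formulas with signed clauses\<close>

lemma expectation_replicate_pmf_of_set:
  fixes f :: "'a list \<Rightarrow> real"
  assumes "finite A" "A \<noteq> {}"
  shows "measure_pmf.expectation (replicate_pmf m (pmf_of_set A)) f
    = (\<Sum>xs | set xs \<subseteq> A \<and> length xs = m. f xs) / real (card A) ^ m"
proof (induction m arbitrary: f)
  case 0
  have "{xs. set xs \<subseteq> A \<and> length xs = 0} = {[]}" by auto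
  then show ?case by simp
next
  case (Suc m)
  let ?L = "{xs. set xs \<subseteq> A \<and> length xs = m}"
  have "finite (set_pmf (replicate_pmf m (pmf_of_set A)))"
    using assms finite_lists_length_eq[of A m]
    by (simp add: set_replicate_pmf lists_eq_set Collect_conj_eq[symmetric] Int_def)
  then have "measure_pmf.expectation (replicate_pmf (Suc m) (pmf_of_set A)) f
      = (\<Sum>a\<in>A. measure_pmf.expectation (replicate_pmf m (pmf_of_set A)) (\<lambda>xs. f (a # xs)) / real (card A))"
    using assms by (simp add: pmf_expectation_bind_pmf_of_set map_pmf_def[symmetric] divide_inverse mult.commute)
  also have "\<dots> = (\<Sum>a\<in>A. \<Sum>xs\<in>?L. f (a # xs)) / real (card A) ^ Suc m"
    by (simp add: Suc.IH sum_divide_distrib mult.commute)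
  also have "(\<Sum>a\<in>A. \<Sum>xs\<in>?L. f (a # xs)) = (\<Sum>(xs, a)\<in>?L \<times> A. f (a # xs))"
    by (subst sum.swap) (simp add: sum.cartesian_product)
  also have "\<dots> = (\<Sum>xs | set xs \<subseteq> A \<and> length xs = Suc m. f xs)"
    unfolding lists_length_Suc_eq
    by (subst sum.reindex) (auto simp: inj_on_def intro!: sum.cong)
  finally show ?case .
qed

text \<open>A clause on the variables \<open>j < i\<close>, with the signs of the two literals as \<open>\<plusminus>1\<close>.\<close>

type_synonym signed_clause = "(nat \<times> nat) \<times> real \<times> real"

definition var_pairs :: "nat \<Rightarrow> (nat \<times> nat) set" where
  "var_pairs n = {(j, i). 1 \<le> j \<and> j < i \<and> i \<le> n}"

definition signed_clauses :: "nat \<Rightarrow> signed_clause set" where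
  "signed_clauses n = var_pairs n \<times> {-1, 1} \<times> {-1, 1}"

definition clause_of :: "signed_clause \<Rightarrow> clause" where
  "clause_of q = (case q of ((j, i), a, b) \<Rightarrow> {(j, a = 1), (i, b = 1)})"

text \<open>Indexing clauses by position gives a \<open>PiE\<close> product, over which exponential
  moments factorise and in which the signs at each position can be resampled separately.\<close>

definition formulas :: "nat \<Rightarrow> nat \<Rightarrow> (nat \<Rightarrow> signed_clause) set" where
  "formulas n m = PiE {..<m} (\<lambda>_. signed_clauses n)"

definition formula_of :: "nat \<Rightarrow> (nat \<Rightarrow> signed_clause) \<Rightarrow> clause list" where
  "formula_of m \<omega> = map (\<lambda>k. clause_of (\<omega> k)) [0..<m]"

lemma finite_var_pairs [simp]: "finite (var_pairs n)"
  by (rule finite_subset[of _ "{1..n} \<times> {1..n}"]) (auto simp: var_pairs_def)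

lemma finite_signed_clauses [simp]: "finite (signed_clauses n)"
  by (simp add: signed_clauses_def)

lemma finite_formulas [simp]: "finite (formulas n m)"
  unfolding formulas_def by (intro finite_PiE) auto

lemma card_formulas: "card (formulas n m) = card (signed_clauses n) ^ m"
  by (simp add: formulas_def card_PiE)

text \<open>Listing the smaller variable first leaves exactly one signed representative of each
  unordered clause.\<close>

lemma bij_betw_clause_of: "bij_betw clause_of (signed_clauses n) (proper_clauses n)"
proof (rule bij_betw_imageI)
  show "inj_on clause_of (signed_clauses n)"
    by (auto simp: inj_on_def clause_of_def signed_clauses_def var_pairs_def doubleton_eq_iff)
  show "clause_of ` signed_clauses n = proper_clauses n"
  proof (intro equalityI subsetI)
    fix C assume "C \<in> proper_clauses n"
    then obtain i a j b where C: "C = {(i, a), (j, b)}" "i \<in> {1..n}" "j \<in> {1..n}" "i \<noteq> j"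
      unfolding proper_clauses_def by blast
    define s :: "bool \<Rightarrow> real" where "s x = (if x then 1 else -1)" for x
    have s: "s x \<in> {-1, 1}" "s x = 1 \<longleftrightarrow> x" for x by (auto simp: s_def)
    show "C \<in> clause_of ` signed_clauses n"
    proof (cases "i < j")
      case True
      then show ?thesis using C s
        by (intro image_eqI[of _ _ "((i, j), s a, s b)"])
          (auto simp: clause_of_def signed_clauses_def var_pairs_def)
    next
      case False
      then show ?thesis using C s
        by (intro image_eqI[of _ _ "((j, i), s b, s a)"])
          (auto simp: clause_of_def signed_clauses_def var_pairs_def)
    qed
  qed (fastforce simp: clause_of_def signed_clauses_def var_pairs_def proper_clauses_def)
qed

text \<open>From here on every expectation is a finite average over \<open>formulas n m\<close>. The
  bound on \<open>n\<close> makes the set of proper clauses nonempty, so the random formula is not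
  the default value.\<close>

lemma expected_max_sat_eq:
  assumes "n \<ge> 2"
  shows "expected_max_sat n m = (\<Sum>\<omega>\<in>formulas n m. real (max_sat (formula_of m \<omega>)))
    / real (card (formulas n m))"
proof -
  let ?P = "proper_clauses n"
  note bij = bij_betw_clause_of[of n]
  have card: "card ?P = card (signed_clauses n)"
    using bij by (simp add: bij_betw_same_card)
  have fin: "finite ?P" using bij_betw_finite[OF bij] by simp
  have "((1, 2), 1, 1) \<in> signed_clauses n" using assms by (auto simp: signed_clauses_def var_pairs_def)
  then have ne: "?P \<noteq> {}" using bij by (auto simp: bij_betw_def)
  define inv where "inv = inv_into (signed_clauses n) clause_of"
  have inv: "inv C \<in> signed_clauses n" "clause_of (inv C) = C" if "C \<in> ?P" for C
    using bij_betw_imp_surj_on[OF bij] that unfolding inv_def by (metis inv_into_into, metis f_inv_into_f)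
  have inv': "inv (clause_of q) = q" if "q \<in> signed_clauses n" for q
    using bij that unfolding inv_def bij_betw_def by auto
  have "(\<Sum>xs | set xs \<subseteq> ?P \<and> length xs = m. real (max_sat xs))
      = (\<Sum>\<omega>\<in>formulas n m. real (max_sat (formula_of m \<omega>)))"
  proof (rule sum.reindex_bij_witness[where i = "formula_of m" and j = "\<lambda>xs. restrict (\<lambda>k. inv (xs ! k)) {..<m}"])
    fix xs assume xs: "xs \<in> {xs. set xs \<subseteq> ?P \<and> length xs = m}"
    then have *: "xs ! k \<in> ?P" if "k < m" for k using that by auto
    show "formula_of m (restrict (\<lambda>k. inv (xs ! k)) {..<m}) = xs"
      using xs * by (intro nth_equalityI) (auto simp: formula_of_def inv)
    then show "real (max_sat (formula_of m (restrict (\<lambda>k. inv (xs ! k)) {..<m}))) = real (max_sat xs)"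
      by simp
    show "restrict (\<lambda>k. inv (xs ! k)) {..<m} \<in> formulas n m"
      using * inv by (auto simp: formulas_def)
  next
    fix \<omega> assume "\<omega> \<in> formulas n m"
    then have *: "\<And>k. k < m \<Longrightarrow> \<omega> k \<in> signed_clauses n"
      and ext: "\<omega> \<in> extensional {..<m}"
      by (auto simp: formulas_def PiE_def)
    then show "formula_of m \<omega> \<in> {xs. set xs \<subseteq> ?P \<and> length xs = m}"
      using bij by (auto simp: formula_of_def bij_betw_def)
    show "restrict (\<lambda>k. inv (formula_of m \<omega> ! k)) {..<m} = \<omega>"
      using * ext by (auto simp: formula_of_def inv' restrict_def extensional_def fun_eq_iff)
  qed
  then show ?thesis
    unfolding expected_max_sat_def random_2sat_def expectation_replicate_pmf_of_set[OF fin ne]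
    by (simp add: card_formulas card)
qed

text \<open>With \<open>\<plusminus>1\<close>-valued assignments \<open>x\<close>, the indicator that \<open>x\<close> satisfies the clause is
  \<open>3/4 + gain/4\<close>.\<close>

definition gain :: "(nat \<Rightarrow> real) \<Rightarrow> signed_clause \<Rightarrow> real" where
  "gain x q = (case q of ((j, i), a, b) \<Rightarrow> a * x j + b * x i - a * b * x j * x i)"

lemma num_satisfied_formula_of:
  assumes "\<omega> \<in> formulas n m" "\<And>i. x i = (if \<sigma> i then 1 else - 1)"
  shows "real (num_satisfied \<sigma> (formula_of m \<omega>)) = 3 / 4 * real m + (\<Sum>k<m. gain x (\<omega> k)) / 4"
proof -
  have ind: "of_bool (satisfies \<sigma> (clause_of q)) = 3 / 4 + gain x q / 4"
    if "q \<in> signed_clauses n" for q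
    using that
    by (auto simp: signed_clauses_def satisfies_def clause_of_def gain_def assms(2) split: prod.splits)
  have "real (num_satisfied \<sigma> (formula_of m \<omega>)) = (\<Sum>k<m. of_bool (satisfies \<sigma> (clause_of (\<omega> k))))"
    unfolding num_satisfied_def formula_of_def
    by (induction m) auto
  also have "\<dots> = (\<Sum>k<m. 3 / 4 + gain x (\<omega> k) / 4)"
    using assms(1) by (intro sum.cong ind refl) (auto simp: formulas_def)
  also have "\<dots> = 3 / 4 * real m + (\<Sum>k<m. gain x (\<omega> k)) / 4"
    by (simp add: sum.distrib sum_divide_distrib)
  finally show ?thesis .
qed

lemma finite_num_satisfied: "finite (range (\<lambda>\<sigma>. num_satisfied \<sigma> F))"
  by (rule finite_subset[of _ "{..length F}"]) (auto simp: num_satisfied_def)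

lemma gain_le_max_sat:
  assumes "\<omega> \<in> formulas n m" "\<And>i. x i \<in> {-1, 1}"
  shows "3 / 4 * real m + (\<Sum>k<m. gain x (\<omega> k)) / 4 \<le> real (max_sat (formula_of m \<omega>))"
proof -
  define \<sigma> where "\<sigma> i \<longleftrightarrow> x i = 1" for i
  have "x i = (if \<sigma> i then 1 else - 1)" for i using assms(2)[of i] by (auto simp: \<sigma>_def)
  then have "real (num_satisfied \<sigma> (formula_of m \<omega>)) = 3 / 4 * real m + (\<Sum>k<m. gain x (\<omega> k)) / 4"
    by (rule num_satisfied_formula_of[OF assms(1)])
  moreover have "num_satisfied \<sigma> (formula_of m \<omega>) \<le> max_sat (formula_of m \<omega>)"
    unfolding max_sat_def by (rule Max_ge[OF finite_num_satisfied]) auto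
  ultimately show ?thesis by simp
qed

lemma max_sat_attained:
  assumes "\<omega> \<in> formulas n m"
  obtains x where "x \<in> signs {1..n}"
    and "real (max_sat (formula_of m \<omega>)) = 3 / 4 * real m + (\<Sum>k<m. gain x (\<omega> k)) / 4"
proof -
  have "max_sat (formula_of m \<omega>) \<in> range (\<lambda>\<sigma>. num_satisfied \<sigma> (formula_of m \<omega>))"
    unfolding max_sat_def by (rule Max_in[OF finite_num_satisfied]) auto
  then obtain \<sigma> where \<sigma>: "max_sat (formula_of m \<omega>) = num_satisfied \<sigma> (formula_of m \<omega>)" by auto
  define x :: "nat \<Rightarrow> real" where "x i = (if \<sigma> i then 1 else - 1)" for i
  \<comment> \<open>Only variables in \<open>{1..n}\<close> occur, so the assignment can be cut down
    to an element of the finite set over which the union bound runs.\<close>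
  have "gain (restrict x {1..n}) (\<omega> k) = gain x (\<omega> k)" if "k < m" for k
  proof -
    have "\<omega> k \<in> signed_clauses n" using assms that by (auto simp: formulas_def)
    then show ?thesis by (auto simp: signed_clauses_def var_pairs_def gain_def)
  qed
  then have "real (max_sat (formula_of m \<omega>)) = 3 / 4 * real m + (\<Sum>k<m. gain (restrict x {1..n}) (\<omega> k)) / 4"
    using num_satisfied_formula_of[OF assms, of x \<sigma>] by (simp add: \<sigma> x_def)
  moreover have "restrict x {1..n} \<in> signs {1..n}"
    by (auto simp: signs_def x_def)
  ultimately show ?thesis using that by blast
qed

section \<open>Counting pairs and signed clauses\<close>

lemma card_var_pairs: "real (card (var_pairs n)) = real n * (real n - 1) / 2"
proof (induction n)
  case 0
  have "var_pairs 0 = {}" by (auto simp: var_pairs_def)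
  then show ?case by simp
next
  case (Suc n)
  have "var_pairs (Suc n) = var_pairs n \<union> {1..n} \<times> {Suc n}"
    by (auto simp: var_pairs_def le_Suc_eq)
  moreover have "var_pairs n \<inter> {1..n} \<times> {Suc n} = {}" by (auto simp: var_pairs_def)
  ultimately have "card (var_pairs (Suc n)) = card (var_pairs n) + n"
    by (simp add: card_Un_disjoint card_cartesian_product)
  then show ?case using Suc.IH by (simp add: field_simps)
qed

lemma sum_signed_clauses:
  fixes f :: "signed_clause \<Rightarrow> real"
  shows "(\<Sum>q\<in>signed_clauses n. f q)
    = (\<Sum>p\<in>var_pairs n. f (p, -1, -1) + f (p, -1, 1) + f (p, 1, -1) + f (p, 1, 1))"
  unfolding signed_clauses_def by (simp add: sum.cartesian_product' add.assoc)

lemma card_signed_clauses: "card (signed_clauses n) = 4 * card (var_pairs n)"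
  by (simp add: signed_clauses_def card_cartesian_product)

lemma signed_clauses_nonempty: "n \<ge> 2 \<Longrightarrow> signed_clauses n \<noteq> {}"
proof -
  assume "n \<ge> 2"
  then have "((1, 2), 1, 1) \<in> signed_clauses n" by (auto simp: signed_clauses_def var_pairs_def)
  then show ?thesis by blast
qed

section \<open>The upper bound\<close>

text \<open>The union bound over \<open>2 ^ n\<close> assignments gives
  \<open>(A + B * t\<^sup>2) / t\<close> with \<open>A = n ln 2\<close> and
  \<open>B = 3 m / 32\<close>; the minimum over \<open>t\<close> is
  \<open>2 * sqrt (A * B)\<close>.\<close>

lemma expected_max_sat_le:
  assumes n: "n \<ge> 2" and m: "m \<ge> 1"
  shows "expected_max_sat n m - 3 / 4 * real m \<le> sqrt (3 * ln 2 / 8 * real n * real m)"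
proof -
  define A where "A = real n * ln 2"
  define B where "B = real m * 3 / 32"
  have AB: "A > 0" "B > 0" using n m by (auto simp: A_def B_def)
  \<comment> \<open>This is the minimiser, at which the two terms of the numerator are
    equal.\<close>
  define t where "t = sqrt (A / B)"
  have t: "t > 0" "t\<^sup>2 = A / B" using AB by (auto simp: t_def)
  have mgf: "(\<Sum>q\<in>signed_clauses n. exp (t * (gain x q / 4)))
      \<le> real (card (signed_clauses n)) * exp (3 * t\<^sup>2 / 32)" if x: "x \<in> signs {1..n}" for x
  proof -
    \<comment> \<open>On each pair of variables exactly one of the four sign patterns is falsified,
      with gain -3; the other three have gain 1.\<close>
    have "(\<Sum>q\<in>signed_clauses n. exp (t * (gain x q / 4)))
        = (\<Sum>p\<in>var_pairs n. exp (- 3 * t / 4) + 3 * exp (t / 4))"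
      unfolding sum_signed_clauses
    proof (rule sum.cong[OF refl])
      fix p assume "p \<in> var_pairs n"
      then obtain j i where p: "p = (j, i)" "j \<in> {1..n}" "i \<in> {1..n}"
        by (auto simp: var_pairs_def)
      then have "x j \<in> {-1, 1}" "x i \<in> {-1, 1}" using x by (auto simp: signs_def)
      then show "exp (t * (gain x (p, - 1, - 1) / 4)) + exp (t * (gain x (p, - 1, 1) / 4)) +
          exp (t * (gain x (p, 1, - 1) / 4)) + exp (t * (gain x (p, 1, 1) / 4))
          = exp (- 3 * t / 4) + 3 * exp (t / 4)"
        by (auto simp: p(1) gain_def)
    qed
    also have "\<dots> = real (card (var_pairs n)) * (exp (- 3 * t / 4) + 3 * exp (t / 4))" by simp
    also have "\<dots> \<le> real (card (var_pairs n)) * (4 * exp (3 * t\<^sup>2 / 32))"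
      using t by (intro mult_left_mono bernoulli_three_quarters_mgf) auto
    finally show ?thesis by (simp add: card_signed_clauses)
  qed
  have attained: "\<exists>x\<in>signs {1..n}. real (max_sat (formula_of m \<omega>)) - 3 / 4 * real m \<le> (\<Sum>k<m. gain x (\<omega> k) / 4)"
    if "\<omega> \<in> PiE {..<m} (\<lambda>_. signed_clauses n)" for \<omega>
    using max_sat_attained[of \<omega> n m] that
    unfolding formulas_def by (metis add_diff_cancel_left' order_refl sum_divide_distrib)
  have "(\<lambda>_\<in>{1..n}. 1) \<in> signs {1..n}" by (auto simp: signs_def)
  then have ne: "signs {1..n} \<noteq> {}" by blast
  define N where "N = real (card (formulas n m))"
  have N: "N > 0" using signed_clauses_nonempty[OF n]
    by (simp add: N_def card_formulas card_gt_0_iff)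
  have "(\<Sum>\<omega>\<in>formulas n m. real (max_sat (formula_of m \<omega>)) - 3 / 4 * real m) \<le> N * ((A + B * t\<^sup>2) / t)"
    using sum_max_le_of_mgf[OF finite_lessThan finite_signed_clauses signed_clauses_nonempty[OF n]
        finite_signs[OF finite_atLeastAtMost] ne t(1) mgf attained]
    by (simp add: N_def card_formulas formulas_def[symmetric] card_signs A_def B_def ln_realpow mult_ac)
  also have "(A + B * t\<^sup>2) / t = 2 * A / t" using AB by (simp add: t(2))
  also have "\<dots> = 2 * sqrt (A * B)"
  proof -
    have "A / t = sqrt (A\<^sup>2 / (A / B))" using AB by (simp add: t_def real_sqrt_divide real_sqrt_mult)
    also have "A\<^sup>2 / (A / B) = A * B" using AB by (simp add: power2_eq_square field_simps)
    finally show ?thesis by simp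
  qed
  also have "\<dots> = sqrt (4 * (A * B))" by (simp add: real_sqrt_mult)
  also have "4 * (A * B) = 3 * ln 2 / 8 * real n * real m" by (simp add: A_def B_def)
  finally have "((\<Sum>\<omega>\<in>formulas n m. real (max_sat (formula_of m \<omega>))) - N * (3 / 4 * real m)) / N
      \<le> sqrt (3 * ln 2 / 8 * real n * real m)"
    using N by (simp add: sum_subtractf divide_le_eq mult.commute N_def)
  then show ?thesis
    using N by (simp add: expected_max_sat_eq[OF n] N_def[symmetric] diff_divide_distrib)
qed

section \<open>The greedy assignment\<close>

text \<open>If the variables below \<open>i\<close> have been set by \<open>x\<close> and those above \<open>i\<close> are averaged over, the
  expected gain of the clause \<open>q\<close> changes by \<open>influence x i q\<close> times the value given to \<open>i\<close>.\<close>

definition influence :: "(nat \<Rightarrow> real) \<Rightarrow> nat \<Rightarrow> signed_clause \<Rightarrow> real" where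
  "influence x i q = (case q of ((j, i'), a, b) \<Rightarrow>
     (if j = i then a else 0) + (if i' = i then b * (1 - a * x j) else 0))"

lemma gain_eq_sum_influence:
  assumes "q \<in> signed_clauses n"
  shows "gain x q = (\<Sum>i\<in>{1..n}. x i * influence x i q)"
proof -
  obtain j i a b where q: "q = ((j, i), a, b)" "1 \<le> j" "j < i" "i \<le> n"
    using assms by (auto simp: signed_clauses_def var_pairs_def)
  have "(\<Sum>k\<in>{1..n}. x k * influence x k q)
      = (\<Sum>k\<in>{1..n}. (if k = j then x k * a else 0) + (if k = i then x k * (b * (1 - a * x j)) else 0))"
    by (intro sum.cong) (auto simp: influence_def q(1) algebra_simps)
  also have "\<dots> = x j * a + x i * (b * (1 - a * x j))"
    using q by (auto simp: sum.distrib)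
  finally show ?thesis by (simp add: gain_def q(1) algebra_simps)
qed

text \<open>The influence on \<open>i\<close> reads only the values of smaller variables, so
  decisions at \<open>i\<close> or later leave it unchanged.\<close>

lemma influence_cong:
  assumes "q \<in> signed_clauses n" "\<And>j. 1 \<le> j \<Longrightarrow> j < i \<Longrightarrow> x j = y j"
  shows "influence x i q = influence y i q"
  using assms by (auto simp: influence_def signed_clauses_def var_pairs_def)

lemma abs_influence_le:
  assumes "q \<in> signed_clauses n" "\<And>j. x j \<in> {-1, 1}"
  shows "\<bar>influence x i q\<bar> \<le> 2"
proof -
  obtain j i' a b where q: "q = ((j, i'), a, b)" "j < i'" "a \<in> {-1, 1}" "b \<in> {-1, 1}"
    using assms(1) by (auto simp: signed_clauses_def var_pairs_def)
  show ?thesis using q assms(2)[of j] by (auto simp: influence_def)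
qed

text \<open>After \<open>r\<close> steps the variables \<open>1..r\<close> are decided. The others
  keep the value 1, so the function is sign-valued everywhere, as \<open>gain_le_max_sat\<close>
  demands; ties also go to 1.\<close>

primrec greedy :: "nat \<Rightarrow> (nat \<Rightarrow> signed_clause) \<Rightarrow> nat \<Rightarrow> nat \<Rightarrow> real" where
  "greedy m \<omega> 0 = (\<lambda>_. 1)"
| "greedy m \<omega> (Suc r) = (greedy m \<omega> r)(Suc r :=
     if 0 \<le> (\<Sum>k<m. influence (greedy m \<omega> r) (Suc r) (\<omega> k)) then 1 else - 1)"

lemma greedy_sign: "greedy m \<omega> r i \<in> {-1, 1}"
  by (induction r) auto

lemma greedy_stable: "i \<le> r \<Longrightarrow> r \<le> s \<Longrightarrow> greedy m \<omega> s i = greedy m \<omega> r i"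
  by (induction s) (auto simp: le_Suc_eq)

lemma influence_greedy:
  assumes "\<omega> \<in> formulas n m" "k < m" "Suc r \<le> n"
  shows "influence (greedy m \<omega> n) (Suc r) (\<omega> k) = influence (greedy m \<omega> r) (Suc r) (\<omega> k)"
  using assms by (intro influence_cong[of _ n] greedy_stable) (auto simp: formulas_def)

lemma sum_gain_greedy:
  assumes "\<omega> \<in> formulas n m"
  shows "(\<Sum>k<m. gain (greedy m \<omega> n) (\<omega> k))
    = (\<Sum>i\<in>{1..n}. \<bar>\<Sum>k<m. influence (greedy m \<omega> n) i (\<omega> k)\<bar>)"
proof -
  let ?x = "greedy m \<omega> n"
  have mem: "\<omega> k \<in> signed_clauses n" if "k < m" for k
    using assms that by (auto simp: formulas_def)
  have "(\<Sum>k<m. gain ?x (\<omega> k)) = (\<Sum>k<m. \<Sum>i\<in>{1..n}. ?x i * influence ?x i (\<omega> k))"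
    using mem by (intro sum.cong gain_eq_sum_influence) auto
  also have "\<dots> = (\<Sum>i\<in>{1..n}. ?x i * (\<Sum>k<m. influence ?x i (\<omega> k)))"
    by (subst sum.swap) (simp add: sum_distrib_left)
  also have "\<dots> = (\<Sum>i\<in>{1..n}. \<bar>\<Sum>k<m. influence ?x i (\<omega> k)\<bar>)"
  proof (rule sum.cong[OF refl])
    fix i assume i: "i \<in> {1..n}"
    then obtain r where r: "i = Suc r" "Suc r \<le> n" by (cases i) auto
    have "(\<Sum>k<m. influence ?x i (\<omega> k)) = (\<Sum>k<m. influence (greedy m \<omega> r) (Suc r) (\<omega> k))"
      unfolding r(1) using influence_greedy[OF assms _ r(2)] by (intro sum.cong) auto
    moreover have "?x i = greedy m \<omega> (Suc r) (Suc r)"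
      using r greedy_stable[of i "Suc r" n] by simp
    ultimately show "?x i * (\<Sum>k<m. influence ?x i (\<omega> k)) = \<bar>\<Sum>k<m. influence ?x i (\<omega> k)\<bar>"
      by auto
  qed
  finally show ?thesis .
qed

text \<open>The signs that enter the influence of \<open>i\<close> but none of the earlier greedy decisions are
  resampled by multiplying them with \<open>e\<close>.\<close>

definition flip :: "nat \<Rightarrow> nat \<Rightarrow> (nat \<Rightarrow> real) \<Rightarrow> (nat \<Rightarrow> signed_clause) \<Rightarrow> nat \<Rightarrow> signed_clause" where
  "flip m i e \<omega> = restrict (\<lambda>k. case \<omega> k of ((j, i'), a, b) \<Rightarrow>
     ((j, i'), if j = i then a * e k else a, if i' = i then b * e k else b)) {..<m}"

lemma flip_in_formulas:
  assumes "e \<in> signs {..<m}" "\<omega> \<in> formulas n m"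
  shows "flip m i e \<omega> \<in> formulas n m"
proof -
  have "(case \<omega> k of ((j, i'), a, b) \<Rightarrow>
     ((j, i'), if j = i then a * e k else a, if i' = i then b * e k else b)) \<in> signed_clauses n"
    if "k < m" for k
  proof -
    have "\<omega> k \<in> signed_clauses n" using assms(2) that by (auto simp: formulas_def)
    moreover have "e k = -1 \<or> e k = 1" using assms(1) that by (intro sign_cases) auto
    ultimately show ?thesis by (auto simp: signed_clauses_def)
  qed
  then show ?thesis by (auto simp: formulas_def flip_def)
qed

lemma flip_flip:
  assumes "e \<in> signs {..<m}" "\<omega> \<in> formulas n m"
  shows "flip m i e (flip m i e \<omega>) = \<omega>"
proof
  fix k
  show "flip m i e (flip m i e \<omega>) k = \<omega> k"
  proof (cases "k < m")
    case True
    then have "e k = -1 \<or> e k = 1" using assms(1) by (intro sign_cases) auto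
    then have "e k * e k = 1" by auto
    then show ?thesis using True by (auto simp: flip_def mult.assoc split: prod.splits)
  next
    case False
    then have "\<omega> k = undefined" using assms(2) by (auto simp: formulas_def PiE_def extensional_def)
    then show ?thesis using False by (simp add: flip_def)
  qed
qed

lemma sum_formulas_flip:
  assumes "e \<in> signs {..<m}"
  shows "(\<Sum>\<omega>\<in>formulas n m. f (flip m i e \<omega>)) = (\<Sum>\<omega>\<in>formulas n m. f \<omega>)"
  using flip_in_formulas[OF assms] flip_flip[OF assms]
  by (intro sum.reindex_bij_witness[where i = "flip m i e" and j = "flip m i e"]) auto

text \<open>The two variables of a clause differ, so at most one literal is on \<open>i\<close>, and
  its sign enters the influence as a single factor.\<close>

lemma influence_flip_same:
  assumes "\<omega> \<in> formulas n m" "k < m"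
  shows "influence x i (flip m i e \<omega> k) = influence x i (\<omega> k) * e k"
proof -
  have "\<omega> k \<in> signed_clauses n" using assms by (auto simp: formulas_def)
  then show ?thesis using assms(2)
    by (auto simp: flip_def influence_def signed_clauses_def var_pairs_def algebra_simps)
qed

text \<open>If the clause has \<open>r\<close> as larger variable, then \<open>i\<close> does not
  occur in it; if it has \<open>r\<close> as smaller variable, the influence on \<open>r\<close>
  ignores the sign of the other literal.\<close>

lemma influence_flip_less:
  assumes "\<omega> \<in> formulas n m" "k < m" "r < i"
  shows "influence x r (flip m i e \<omega> k) = influence x r (\<omega> k)"
proof -
  have "\<omega> k \<in> signed_clauses n" using assms by (auto simp: formulas_def)
  then show ?thesis using assms(2,3)
    by (auto simp: flip_def influence_def signed_clauses_def var_pairs_def)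
qed

lemma greedy_flip:
  assumes "\<omega> \<in> formulas n m" "r < i"
  shows "greedy m (flip m i e \<omega>) r = greedy m \<omega> r"
  using assms(2)
proof (induction r)
  case (Suc r)
  then show ?case using influence_flip_less[OF assms(1)] by simp
qed simp

text \<open>Each flip permutes the formulas, so the sum may be averaged over all \<open>e\<close>.
  For a fixed formula the flips preserve the greedy decisions below \<open>i\<close>, and the total
  influence becomes a Rademacher sum in \<open>e\<close> with fixed coefficients
  \<open>c \<omega> k\<close>.\<close>

lemma sum_abs_influence_ge:
  assumes i: "i \<in> {1..n}"
  shows "(\<Sum>\<omega>\<in>formulas n m. sqrt (2 / pi) * sqrt (\<Sum>k<m. (influence (greedy m \<omega> n) i (\<omega> k))\<^sup>2) - 4 / pi)
    \<le> (\<Sum>\<omega>\<in>formulas n m. \<bar>\<Sum>k<m. influence (greedy m \<omega> n) i (\<omega> k)\<bar>)"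
proof -
  obtain r where r: "i = Suc r" "Suc r \<le> n" using i by (cases i) auto
  define c where "c \<omega> k = influence (greedy m \<omega> r) i (\<omega> k)" for \<omega> k
  have c: "influence (greedy m \<omega> n) i (\<omega> k) = c \<omega> k" if "\<omega> \<in> formulas n m" "k < m" for \<omega> k
    unfolding c_def r(1) using that r by (intro influence_greedy)
  have flip: "c (flip m i e \<omega>) k = c \<omega> k * e k" if "\<omega> \<in> formulas n m" "k < m" for e \<omega> k
    unfolding c_def using that r by (simp add: greedy_flip influence_flip_same)
  have "2 ^ m * (\<Sum>\<omega>\<in>formulas n m. sqrt (2 / pi) * sqrt (\<Sum>k<m. (c \<omega> k)\<^sup>2) - 4 / pi)
      = (\<Sum>\<omega>\<in>formulas n m. 2 ^ card {..<m} * (sqrt (2 / pi) * sqrt (\<Sum>k<m. (c \<omega> k)\<^sup>2) - 4 / pi))"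
    by (simp add: sum_distrib_left)
  also have "\<dots> \<le> (\<Sum>\<omega>\<in>formulas n m. \<Sum>e\<in>signs {..<m}. \<bar>\<Sum>k<m. c \<omega> k * e k\<bar>)"
  proof (intro sum_mono rademacher_abs_ge finite_lessThan)
    fix \<omega> k assume "\<omega> \<in> formulas n m" "k \<in> {..<m}"
    then show "\<bar>c \<omega> k\<bar> \<le> 2"
      unfolding c_def using greedy_sign by (intro abs_influence_le[of _ n]) (auto simp: formulas_def)
  qed
  also have "\<dots> = (\<Sum>e\<in>signs {..<m}. \<Sum>\<omega>\<in>formulas n m. \<bar>\<Sum>k<m. c (flip m i e \<omega>) k\<bar>)"
    by (subst sum.swap) (auto intro!: sum.cong arg_cong[where f = abs] simp: flip)
  also have "\<dots> = (\<Sum>e\<in>signs {..<m}. \<Sum>\<omega>\<in>formulas n m. \<bar>\<Sum>k<m. c \<omega> k\<bar>)"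
    by (intro sum.cong refl sum_formulas_flip)
  also have "\<dots> = 2 ^ m * (\<Sum>\<omega>\<in>formulas n m. \<bar>\<Sum>k<m. c \<omega> k\<bar>)"
    by (simp add: card_signs)
  finally have "(\<Sum>\<omega>\<in>formulas n m. sqrt (2 / pi) * sqrt (\<Sum>k<m. (c \<omega> k)\<^sup>2) - 4 / pi)
      \<le> (\<Sum>\<omega>\<in>formulas n m. \<bar>\<Sum>k<m. c \<omega> k\<bar>)"
    by simp
  moreover have "(\<Sum>\<omega>\<in>formulas n m. sqrt (2 / pi) * sqrt (\<Sum>k<m. (influence (greedy m \<omega> n) i (\<omega> k))\<^sup>2) - 4 / pi)
      = (\<Sum>\<omega>\<in>formulas n m. sqrt (2 / pi) * sqrt (\<Sum>k<m. (c \<omega> k)\<^sup>2) - 4 / pi)"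
    by (intro sum.cong refl) (simp add: c)
  moreover have "(\<Sum>\<omega>\<in>formulas n m. \<bar>\<Sum>k<m. influence (greedy m \<omega> n) i (\<omega> k)\<bar>)
      = (\<Sum>\<omega>\<in>formulas n m. \<bar>\<Sum>k<m. c \<omega> k\<bar>)"
    by (intro sum.cong refl) (simp add: c)
  ultimately show ?thesis by simp
qed

section \<open>Concentration of the variances\<close>

text \<open>For the smaller variable every square is 1. For the larger one,
  \<open>1 - a * x j\<close> is 0 for one value of \<open>a\<close> and 2 for the other, so the four
  squares are 0, 0, 4, 4.\<close>

lemma influence_square_sum_signs:
  assumes "x j \<in> {-1, 1}" "j < i'"
  shows "(influence x i ((j, i'), -1, -1))\<^sup>2 + (influence x i ((j, i'), -1, 1))\<^sup>2
    + (influence x i ((j, i'), 1, -1))\<^sup>2 + (influence x i ((j, i'), 1, 1))\<^sup>2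
    = 4 * of_bool (j = i) + 8 * of_bool (i' = i)"
  using assms by (auto simp: influence_def)

lemma sum_influence_square:
  assumes "i \<in> {1..n}" and x: "\<And>j. j \<in> {1..n} \<Longrightarrow> x j \<in> {-1, 1}"
  shows "(\<Sum>q\<in>signed_clauses n. (influence x i q)\<^sup>2) = 4 * (real n + real i - 2)"
proof -
  have "(\<Sum>q\<in>signed_clauses n. (influence x i q)\<^sup>2)
      = (\<Sum>p\<in>var_pairs n. 4 * of_bool (fst p = i) + 8 * of_bool (snd p = i))"
    unfolding sum_signed_clauses
  proof (rule sum.cong[OF refl])
    fix p assume "p \<in> var_pairs n"
    then obtain j i' where "p = (j, i')" "j \<in> {1..n}" "j < i'" by (auto simp: var_pairs_def)
    then show "(influence x i (p, -1, -1))\<^sup>2 + (influence x i (p, -1, 1))\<^sup>2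
      + (influence x i (p, 1, -1))\<^sup>2 + (influence x i (p, 1, 1))\<^sup>2
      = 4 * of_bool (fst p = i) + 8 * of_bool (snd p = i)"
      using influence_square_sum_signs[of x j i' i] x by simp
  qed
  also have "\<dots> = 4 * real (card (var_pairs n \<inter> {p. fst p = i})) + 8 * real (card (var_pairs n \<inter> {p. snd p = i}))"
    by (simp add: sum.distrib sum_distrib_left[symmetric] of_bool_def sum.If_cases)
  \<comment> \<open>Variable \<open>i\<close> is the smaller one in \<open>n - i\<close> pairs and
    the larger one in \<open>i - 1\<close> pairs.\<close>
  also have "var_pairs n \<inter> {p. fst p = i} = {i} \<times> {i<..n}"
    using assms by (auto simp: var_pairs_def)
  also have "var_pairs n \<inter> {p. snd p = i} = {1..<i} \<times> {i}"
    using assms by (auto simp: var_pairs_def)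
  also have "4 * real (card ({i} \<times> {i<..n})) + 8 * real (card ({1..<i} \<times> {i})) = 4 * (real n + real i - 2)"
    using assms by (auto simp: card_cartesian_product of_nat_diff)
  finally show ?thesis .
qed

lemma sum_influence_square_le:
  assumes q: "q \<in> signed_clauses n" and x: "\<And>j. j \<in> {1..n} \<Longrightarrow> x j \<in> {-1, 1}"
  shows "(\<Sum>i\<in>{1..n}. (influence x i q)\<^sup>2) \<le> 5"
proof -
  obtain j i' a b where q: "q = ((j, i'), a, b)" "1 \<le> j" "j < i'" "i' \<le> n" "a \<in> {-1, 1}" "b \<in> {-1, 1}"
    using q by (auto simp: signed_clauses_def var_pairs_def)
  then have "x j \<in> {-1, 1}" by (intro x) auto
  then have "(b * (1 - a * x j))\<^sup>2 \<le> 4" using q by auto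
  moreover have "(\<Sum>i\<in>{1..n}. (influence x i q)\<^sup>2)
      = (\<Sum>i\<in>{1..n}. (if i = j then a\<^sup>2 else 0) + (if i = i' then (b * (1 - a * x j))\<^sup>2 else 0))"
    using q by (intro sum.cong) (auto simp: influence_def)
  moreover have "\<dots> = a\<^sup>2 + (b * (1 - a * x j))\<^sup>2" using q by (simp add: sum.distrib)
  moreover have "a\<^sup>2 = 1" using q by auto
  ultimately show ?thesis by linarith
qed

text \<open>This is the mean squared influence on \<open>i\<close> of a uniform clause. It is the
  same for every sign assignment, which lets one centring serve the whole union bound.\<close>

definition mean_square :: "nat \<Rightarrow> nat \<Rightarrow> real" where
  "mean_square n i = 2 * (real n + real i - 2) / (real n * (real n - 1))"

lemma mean_square_eq:
  assumes n: "n \<ge> 2" and i: "i \<in> {1..n}" and x: "\<And>j. j \<in> {1..n} \<Longrightarrow> x j \<in> {-1, 1}"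
  shows "(\<Sum>q\<in>signed_clauses n. (influence x i q)\<^sup>2) = real (card (signed_clauses n)) * mean_square n i"
  using sum_influence_square[OF i, of x] x n
  by (simp add: mean_square_def card_signed_clauses card_var_pairs)

text \<open>The bound has the shape of a left-endpoint Riemann sum for \<open>sqrt (1 + t)\<close>;
  after cross-multiplication it reduces to \<open>1 \<le> i\<close>.\<close>

lemma mean_square_ge:
  assumes n: "n \<ge> 2" and i: "i \<ge> 1"
  shows "2 / real n * (1 + real (i - 1) / real n) \<le> mean_square n i"
proof -
  have "(real n + real i - 1) * (real n - 1) \<le> (real n + real i - 2) * real n"
    using i by (simp add: algebra_simps)
  then have "(real n + real i - 1) / real n \<le> (real n + real i - 2) / (real n - 1)"
    using n by (simp add: divide_simps)
  then have "2 / real n * ((real n + real i - 1) / real n) \<le> 2 / real n * ((real n + real i - 2) / (real n - 1))"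
    by (intro mult_left_mono) auto
  moreover have "1 + real (i - 1) / real n = (real n + real i - 1) / real n"
    using n i by (simp add: of_nat_diff field_simps)
  moreover have "mean_square n i = 2 / real n * ((real n + real i - 2) / (real n - 1))"
    by (simp add: mean_square_def)
  ultimately show ?thesis by simp
qed

text \<open>Averaging the bound per clause over all clauses suffices; the constant assignment 1
  serves as a representative.\<close>

lemma sum_mean_square_le:
  assumes n: "n \<ge> 2"
  shows "(\<Sum>i\<in>{1..n}. mean_square n i) \<le> 5"
proof -
  let ?N = "real (card (signed_clauses n))"
  have N: "?N > 0" using signed_clauses_nonempty[OF n] by (simp add: card_gt_0_iff)
  have "?N * (\<Sum>i\<in>{1..n}. mean_square n i) = (\<Sum>q\<in>signed_clauses n. \<Sum>i\<in>{1..n}. (influence (\<lambda>_. 1) i q)\<^sup>2)"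
    by (subst sum.swap) (auto simp: sum_distrib_left mean_square_eq[OF n, symmetric] intro!: sum.cong)
  also have "\<dots> \<le> (\<Sum>q\<in>signed_clauses n. 5)"
    by (intro sum_mono sum_influence_square_le) auto
  finally show ?thesis using N by simp
qed

text \<open>The signs \<open>y\<close> linearise the absolute values: with \<open>y i\<close> the
  sign of the i-th difference, the sum of \<open>deviation\<close> over the clauses of a formula is
  the sum of the absolute differences.\<close>

definition deviation :: "nat \<Rightarrow> (nat \<Rightarrow> real) \<Rightarrow> (nat \<Rightarrow> real) \<Rightarrow> signed_clause \<Rightarrow> real" where
  "deviation n x y q = (\<Sum>i\<in>{1..n}. y i * ((influence x i q)\<^sup>2 - mean_square n i))"

lemma sum_deviation:
  assumes n: "n \<ge> 2" and x: "\<And>j. j \<in> {1..n} \<Longrightarrow> x j \<in> {-1, 1}"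
  shows "(\<Sum>q\<in>signed_clauses n. deviation n x y q) = 0"
proof -
  have "(\<Sum>q\<in>signed_clauses n. deviation n x y q)
      = (\<Sum>i\<in>{1..n}. y i * ((\<Sum>q\<in>signed_clauses n. (influence x i q)\<^sup>2) - real (card (signed_clauses n)) * mean_square n i))"
    unfolding deviation_def by (subst sum.swap) (simp add: sum_distrib_left[symmetric] sum_subtractf)
  also have "\<dots> = 0" using mean_square_eq[OF n _ x] by simp
  finally show ?thesis .
qed

lemma abs_deviation_le:
  assumes n: "n \<ge> 2" and q: "q \<in> signed_clauses n"
    and x: "\<And>j. j \<in> {1..n} \<Longrightarrow> x j \<in> {-1, 1}" and y: "\<And>j. j \<in> {1..n} \<Longrightarrow> y j \<in> {-1, 1}"
  shows "\<bar>deviation n x y q\<bar> \<le> 10"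
proof -
  have "\<bar>deviation n x y q\<bar> \<le> (\<Sum>i\<in>{1..n}. \<bar>y i * ((influence x i q)\<^sup>2 - mean_square n i)\<bar>)"
    unfolding deviation_def by (rule sum_abs)
  also have "\<dots> \<le> (\<Sum>i\<in>{1..n}. (influence x i q)\<^sup>2 + mean_square n i)"
  proof (rule sum_mono)
    fix i assume i: "i \<in> {1..n}"
    have "\<bar>y i\<bar> = 1" using y[OF i] by auto
    moreover have "0 \<le> mean_square n i" using n i by (simp add: mean_square_def)
    ultimately show "\<bar>y i * ((influence x i q)\<^sup>2 - mean_square n i)\<bar> \<le> (influence x i q)\<^sup>2 + mean_square n i"
      by (simp add: abs_mult abs_le_iff)
  qed
  also have "\<dots> \<le> 5 + 5"
    unfolding sum.distrib by (intro add_mono sum_influence_square_le[OF q x] sum_mean_square_le[OF n])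
  finally show ?thesis by simp
qed

text \<open>The greedy assignment depends on the formula, so the variances of the influences are not
  sums of independent terms; a union bound over all assignments replaces independence.\<close>

lemma sum_variance_deviation_le:
  assumes n: "n \<ge> 2" and m: "m \<ge> 100 * n"
  shows "(\<Sum>\<omega>\<in>formulas n m. \<Sum>i\<in>{1..n}.
      \<bar>(\<Sum>k<m. (influence (greedy m \<omega> n) i (\<omega> k))\<^sup>2) - real m * mean_square n i\<bar>)
    \<le> real (card (formulas n m)) * (102 * sqrt (real n * real m))"
proof -
  let ?S = "signs {1..n}"
  \<comment> \<open>This makes the second-order term \<open>100 * m * t\<^sup>2\<close> equal to
    \<open>100 * n\<close>, of the same order as the logarithm of the number of pairs
    \<open>(x, y)\<close>, which is at most \<open>2 * n\<close>; together they give 102.\<close>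
  define t where "t = sqrt (real n / real m)"
  have pos: "real n > 0" "real m > 0" using n m by auto
  then have t: "t > 0" "t\<^sup>2 = real n / real m" by (auto simp: t_def)
  \<comment> \<open>The factor 10 is the bound on \<open>deviation\<close>; this is where
    \<open>m \<ge> 100 * n\<close> enters.\<close>
  have "t * 10 \<le> 1"
  proof -
    have "(t * 10)\<^sup>2 \<le> 1\<^sup>2" using m pos by (simp add: power_mult_distrib t(2) divide_simps)
    then show ?thesis by (rule power2_le_imp_le) simp
  qed
  have sign: "z j \<in> {-1, 1}" if "z \<in> ?S" "j \<in> {1..n}" for z j
    using sign_cases[OF that] by auto
  have mgf: "(\<Sum>q\<in>signed_clauses n. exp (t * (\<lambda>(x, y). deviation n x y) \<tau> q))
      \<le> real (card (signed_clauses n)) * exp (t\<^sup>2 * 10\<^sup>2)" if mem: "\<tau> \<in> ?S \<times> ?S" for \<tau>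
  proof -
    obtain x y where \<tau>: "\<tau> = (x, y)" "x \<in> ?S" "y \<in> ?S" using mem by auto
    show ?thesis unfolding \<tau>(1) prod.case
      using \<open>t * 10 \<le> 1\<close> t(1) \<tau>(2,3)
      by (intro sum_exp_centered_le finite_signed_clauses sum_deviation[OF n] abs_deviation_le[OF n] sign) auto
  qed
  define Z where "Z \<omega> = (\<Sum>i\<in>{1..n}.
      \<bar>(\<Sum>k<m. (influence (greedy m \<omega> n) i (\<omega> k))\<^sup>2) - real m * mean_square n i\<bar>)" for \<omega>
  have attained: "\<exists>\<tau>\<in>?S \<times> ?S. Z \<omega> \<le> (\<Sum>k<m. (\<lambda>(x, y). deviation n x y) \<tau> (\<omega> k))"
    if "\<omega> \<in> PiE {..<m} (\<lambda>_. signed_clauses n)" for \<omega>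
  proof -
    define x where "x = restrict (greedy m \<omega> n) {1..n}"
    define d where "d i = (\<Sum>k<m. (influence x i (\<omega> k))\<^sup>2) - real m * mean_square n i" for i
    define y :: "nat \<Rightarrow> real" where "y = restrict (\<lambda>i. if d i \<ge> 0 then 1 else -1) {1..n}"
    have x: "x \<in> ?S" unfolding x_def signs_def restrict_PiE_iff using greedy_sign by blast
    have y: "y \<in> ?S" by (auto simp: y_def signs_def)
    have "influence (greedy m \<omega> n) i (\<omega> k) = influence x i (\<omega> k)" if "i \<in> {1..n}" "k < m" for i k
      using that \<open>\<omega> \<in> _\<close> by (intro influence_cong[of _ n]) (auto simp: x_def)
    then have "Z \<omega> = (\<Sum>i\<in>{1..n}. \<bar>d i\<bar>)"
      unfolding Z_def d_def by (intro sum.cong refl arg_cong[where f = abs]) simp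
    also have "\<dots> = (\<Sum>i\<in>{1..n}. y i * d i)"
      by (intro sum.cong) (auto simp: y_def)
    also have "\<dots> = (\<Sum>i\<in>{1..n}. \<Sum>k<m. y i * ((influence x i (\<omega> k))\<^sup>2 - mean_square n i))"
      by (simp add: d_def sum_subtractf sum_distrib_left[symmetric])
    also have "\<dots> = (\<Sum>k<m. deviation n x y (\<omega> k))"
      unfolding deviation_def by (rule sum.swap)
    finally show ?thesis using x y by (intro bexI[of _ "(x, y)"]) auto
  qed
  have "(\<lambda>_\<in>{1..n}. 1) \<in> ?S" by (auto simp: signs_def)
  then have ne: "?S \<times> ?S \<noteq> {}" by blast
  have fin: "finite (?S \<times> ?S)" by simp
  have "(\<Sum>\<omega>\<in>formulas n m. Z \<omega>) \<le> real (card (formulas n m)) * ((ln (real (card (?S \<times> ?S))) + real m * (t\<^sup>2 * 10\<^sup>2)) / t)"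
    using sum_max_le_of_mgf[OF finite_lessThan finite_signed_clauses signed_clauses_nonempty[OF n]
        fin ne t(1) mgf attained]
    by (simp add: card_formulas formulas_def[symmetric])
  also have "\<dots> \<le> real (card (formulas n m)) * (102 * sqrt (real n * real m))"
  proof (rule mult_left_mono)
    have "ln (real (card (?S \<times> ?S))) = 2 * real n * ln 2"
      by (simp add: card_cartesian_product card_signs ln_mult ln_realpow)
    also have "\<dots> \<le> 2 * real n * 1" using ln_2_less_1 by (intro mult_left_mono) auto
    finally have "ln (real (card (?S \<times> ?S))) + real m * (t\<^sup>2 * 10\<^sup>2) \<le> 102 * real n"
      using pos by (simp add: t(2))
    then have "(ln (real (card (?S \<times> ?S))) + real m * (t\<^sup>2 * 10\<^sup>2)) / t \<le> 102 * real n / t"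
      using t by (intro divide_right_mono) auto
    also have "\<dots> = 102 * (real n / t)" by simp
    also have "real n / t = sqrt (real n * real m)"
    proof -
      have "real n = sqrt (real n) * sqrt (real n)" by simp
      then show ?thesis using pos by (simp add: t_def real_sqrt_divide real_sqrt_mult divide_simps)
    qed
    finally show "(ln (real (card (?S \<times> ?S))) + real m * (t\<^sup>2 * 10\<^sup>2)) / t \<le> 102 * sqrt (real n * real m)" .
  qed simp
  finally show ?thesis unfolding Z_def .
qed

section \<open>Square roots of the variances and their Riemann sum\<close>

lemma sqrt_ge_linear:
  fixes v \<mu> :: real
  assumes "0 \<le> v" "0 < w" "w \<le> \<mu>"
  shows "sqrt \<mu> - \<bar>v - \<mu>\<bar> / sqrt w \<le> sqrt v"
proof -
  have \<mu>: "\<mu> > 0" using assms by simp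
  \<comment> \<open>The difference of square roots is
    \<open>(\<mu> - v) / (sqrt \<mu> + sqrt v)\<close>. The common lower bound \<open>w\<close> then
    gives a denominator that can be pulled out of a sum over variables.\<close>
  have "(sqrt \<mu> - sqrt v) * sqrt \<mu> \<le> \<bar>v - \<mu>\<bar>"
  proof (cases "v \<le> \<mu>")
    case True
    then have "(sqrt \<mu> - sqrt v) * sqrt \<mu> \<le> (sqrt \<mu> - sqrt v) * (sqrt \<mu> + sqrt v)"
      using assms by (intro mult_left_mono) auto
    also have "\<dots> = \<mu> - v" using assms \<mu> by (simp add: algebra_simps)
    finally show ?thesis using True by simp
  next
    case False
    then have "(sqrt \<mu> - sqrt v) * sqrt \<mu> \<le> 0" using \<mu> by (intro mult_nonpos_nonneg) auto
    then show ?thesis by linarith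
  qed
  then have "sqrt \<mu> - sqrt v \<le> \<bar>v - \<mu>\<bar> / sqrt \<mu>" using \<mu> by (simp add: field_simps)
  also have "\<dots> \<le> \<bar>v - \<mu>\<bar> / sqrt w" using assms by (intro divide_left_mono) auto
  finally show ?thesis by simp
qed

lemma sum_sqrt_ge:
  assumes "n \<ge> 1"
  shows "real n * (2 / 3 * (sqrt 8 - 1)) - 1 \<le> (\<Sum>i\<in>{1..n}. sqrt (1 + real (i - 1) / real n))"
proof -
  \<comment> \<open>\<open>F\<close> is an antiderivative of \<open>sqrt (1 + t)\<close>; by the
    mean value theorem each increment, scaled by \<open>n\<close>, is at most the right-endpoint
    value.\<close>
  define F where "F t = 2 / 3 * ((1 + t) * sqrt (1 + t))" for t :: real
  have F': "(F has_real_derivative sqrt (1 + t)) (at t)" if "t \<ge> 0" for t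
  proof -
    have "(F has_real_derivative 2 / 3 * (sqrt (1 + t) + (1 + t) * (inverse (sqrt (1 + t)) / 2))) (at t)"
      unfolding F_def[abs_def] using that by (auto intro!: derivative_eq_intros simp: field_simps)
    moreover have "(1 + t) * (inverse (sqrt (1 + t)) / 2) = sqrt (1 + t) / 2"
      using that by (simp add: real_div_sqrt field_simps)
    ultimately show ?thesis by simp
  qed
  have step: "real n * (F (real i / real n) - F (real (i - 1) / real n)) \<le> sqrt (1 + real i / real n)"
    if i: "i \<in> {1..n}" for i
  proof -
    have lt: "real (i - 1) / real n < real i / real n"
      using i by (intro divide_strict_right_mono) auto
    obtain z where z: "real (i - 1) / real n < z" "z < real i / real n"
      "F (real i / real n) - F (real (i - 1) / real n) = (real i / real n - real (i - 1) / real n) * sqrt (1 + z)"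
    proof -
      have "(F has_real_derivative sqrt (1 + x)) (at x)" if "real (i - 1) / real n \<le> x" for x
        using that by (intro F' order_trans[OF _ that]) auto
      with MVT2[OF lt, of F "\<lambda>x. sqrt (1 + x)"] show ?thesis using that by blast
    qed
    have "real i / real n - real (i - 1) / real n = 1 / real n"
      using i by (simp add: of_nat_diff diff_divide_distrib)
    then have "real n * (F (real i / real n) - F (real (i - 1) / real n)) = sqrt (1 + z)"
      using z(3) assms by simp
    also have "\<dots> \<le> sqrt (1 + real i / real n)" using z by simp
    finally show ?thesis .
  qed
  have tele: "(\<Sum>i\<in>{1..k}. f i - f (i - 1)) = f k - f 0" for f :: "nat \<Rightarrow> real" and k
    by (induction k) auto
  have "real n * (F 1 - F 0) = (\<Sum>i\<in>{1..n}. real n * (F (real i / real n) - F (real (i - 1) / real n)))"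
    using tele[of "\<lambda>i. F (real i / real n)" n] assms by (simp add: sum_distrib_left[symmetric])
  also have "\<dots> \<le> (\<Sum>i\<in>{1..n}. sqrt (1 + real i / real n))"
    by (intro sum_mono step)
  \<comment> \<open>Passing from right to left endpoints costs \<open>sqrt 2 - 1\<close>, hence less
    than 1.\<close>
  also have "\<dots> = (\<Sum>i\<in>{1..n}. sqrt (1 + real (i - 1) / real n)) + (sqrt 2 - 1)"
    using tele[of "\<lambda>i. sqrt (1 + real i / real n)" n] assms by (simp add: sum_subtractf)
  also have "sqrt 2 \<le> (2 :: real)" using sqrt2_less_2 by simp
  also have "F 1 - F 0 = 2 / 3 * (sqrt 8 - 1)"
  proof -
    have "sqrt 8 = sqrt (2\<^sup>2 * 2)" by simp
    also have "\<dots> = 2 * sqrt 2" by (subst real_sqrt_mult) simp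
    finally show ?thesis by (simp add: F_def)
  qed
  finally show ?thesis by simp
qed

section \<open>The lower bound\<close>

text \<open>Replacing each variance \<open>V \<omega> i\<close> by \<open>\<mu> i\<close> costs at
  most \<open>102 * n\<close> on average, and the terms \<open>4 / pi\<close> cost at most
  \<open>2 * n\<close>. The excess is a quarter of the total influence, and a quarter of
  \<open>104 * n\<close> lies below \<open>27 * n\<close>.\<close>

lemma expected_max_sat_ge:
  assumes n: "n \<ge> 2" and m: "m \<ge> 100 * n"
  shows "sqrt (2 / pi) / 4 * (sqrt (2 * real m / real n) * (real n * (2 / 3 * (sqrt 8 - 1)) - 1)) - 27 * real n
    \<le> expected_max_sat n m - 3 / 4 * real m"
proof -
  define w where "w = 2 * real m / real n"
  define \<mu> where "\<mu> i = real m * mean_square n i" for i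
  define V where "V \<omega> i = (\<Sum>k<m. (influence (greedy m \<omega> n) i (\<omega> k))\<^sup>2)" for \<omega> i
  define N where "N = real (card (formulas n m))"
  define r where "r = sqrt (2 / pi)"
  define S where "S = (\<Sum>i\<in>{1..n}. sqrt (\<mu> i))"
  have pos: "real n > 0" "real m > 0" using n m by auto
  have w: "w > 0" using pos by (simp add: w_def)
  have r: "0 \<le> r" "r \<le> 1" using pi_gt3 by (auto simp: r_def)
  have N: "N > 0" using signed_clauses_nonempty[OF n]
    by (simp add: N_def card_formulas card_gt_0_iff)
  have \<mu>: "w * (1 + real (i - 1) / real n) \<le> \<mu> i" if "i \<in> {1..n}" for i
    using mult_left_mono[OF mean_square_ge[OF n, of i], of "real m"] that
    by (simp add: w_def \<mu>_def mult_ac)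
  have w\<mu>: "w \<le> \<mu> i" if "i \<in> {1..n}" for i
  proof -
    have "w * 1 \<le> w * (1 + real (i - 1) / real n)" using w by (intro mult_left_mono) auto
    with \<mu>[OF that] show ?thesis by simp
  qed
  have S: "sqrt w * (real n * (2 / 3 * (sqrt 8 - 1)) - 1) \<le> S"
  proof -
    have "sqrt w * (real n * (2 / 3 * (sqrt 8 - 1)) - 1)
        \<le> sqrt w * (\<Sum>i\<in>{1..n}. sqrt (1 + real (i - 1) / real n))"
      using n w by (intro mult_left_mono sum_sqrt_ge) auto
    also have "\<dots> \<le> S"
      unfolding S_def sum_distrib_left real_sqrt_mult[symmetric]
      by (intro sum_mono real_sqrt_le_mono \<mu>)
    finally show ?thesis .
  qed
  have V: "(\<Sum>i\<in>{1..n}. r * sqrt (V \<omega> i) - 4 / pi) \<ge> r * S - r * ((\<Sum>i\<in>{1..n}. \<bar>V \<omega> i - \<mu> i\<bar>) / sqrt w) - 2 * real n" for \<omega>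
  proof -
    have "S - (\<Sum>i\<in>{1..n}. \<bar>V \<omega> i - \<mu> i\<bar>) / sqrt w = (\<Sum>i\<in>{1..n}. sqrt (\<mu> i) - \<bar>V \<omega> i - \<mu> i\<bar> / sqrt w)"
      by (simp add: S_def sum_subtractf sum_divide_distrib)
    also have "\<dots> \<le> (\<Sum>i\<in>{1..n}. sqrt (V \<omega> i))"
      by (intro sum_mono sqrt_ge_linear w w\<mu>) (auto simp: V_def intro: sum_nonneg)
    finally have "r * (S - (\<Sum>i\<in>{1..n}. \<bar>V \<omega> i - \<mu> i\<bar>) / sqrt w) \<le> r * (\<Sum>i\<in>{1..n}. sqrt (V \<omega> i))"
      using r by (intro mult_left_mono)
    moreover have "4 / pi * real n \<le> 2 * real n"
      using pi_gt3 by (intro mult_right_mono) (auto simp: divide_simps)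
    ultimately show ?thesis
      by (simp add: sum_subtractf sum_distrib_left[symmetric] algebra_simps)
  qed
  have dev: "(\<Sum>\<omega>\<in>formulas n m. \<Sum>i\<in>{1..n}. \<bar>V \<omega> i - \<mu> i\<bar>) \<le> N * (102 * sqrt (real n * real m))"
    using sum_variance_deviation_le[OF n m] by (simp add: V_def \<mu>_def N_def)
  \<comment> \<open>Dividing the deviation by \<open>sqrt w\<close> cancels \<open>m\<close>, so the
    error per variable stays bounded however large the clause density is.\<close>
  have sqrt_ratio: "sqrt (real n * real m) / sqrt w \<le> real n"
  proof -
    have "real n * real m / w \<le> (real n)\<^sup>2" using pos by (simp add: w_def power2_eq_square field_simps)
    then have "sqrt (real n * real m / w) \<le> real n" by (intro real_le_lsqrt) auto
    then show ?thesis by (simp add: real_sqrt_divide)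
  qed
  have "N * (r * S - 104 * real n)
      \<le> N * (r * S) - r * ((N * (102 * sqrt (real n * real m))) / sqrt w) - N * (2 * real n)"
  proof -
    have "r * (102 * (sqrt (real n * real m) / sqrt w)) \<le> 1 * (102 * real n)"
      using r sqrt_ratio w by (intro mult_mono) auto
    from mult_left_mono[OF this, of N] N show ?thesis by (simp add: algebra_simps)
  qed
  also have "\<dots> \<le> N * (r * S) - r * ((\<Sum>\<omega>\<in>formulas n m. \<Sum>i\<in>{1..n}. \<bar>V \<omega> i - \<mu> i\<bar>) / sqrt w) - N * (2 * real n)"
    using r w N dev by (intro diff_mono mult_left_mono divide_right_mono) auto
  also have "\<dots> = (\<Sum>\<omega>\<in>formulas n m. r * S - r * ((\<Sum>i\<in>{1..n}. \<bar>V \<omega> i - \<mu> i\<bar>) / sqrt w) - 2 * real n)"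
    by (simp add: sum_subtractf N_def sum_distrib_left[symmetric] sum_divide_distrib[symmetric])
  also have "\<dots> \<le> (\<Sum>\<omega>\<in>formulas n m. \<Sum>i\<in>{1..n}. r * sqrt (V \<omega> i) - 4 / pi)"
    by (intro sum_mono V)
  also have "\<dots> = (\<Sum>i\<in>{1..n}. \<Sum>\<omega>\<in>formulas n m. r * sqrt (V \<omega> i) - 4 / pi)"
    by (rule sum.swap)
  also have "\<dots> \<le> (\<Sum>i\<in>{1..n}. \<Sum>\<omega>\<in>formulas n m. \<bar>\<Sum>k<m. influence (greedy m \<omega> n) i (\<omega> k)\<bar>)"
    unfolding V_def r_def by (intro sum_mono sum_abs_influence_ge)
  also have "\<dots> = (\<Sum>\<omega>\<in>formulas n m. \<Sum>k<m. gain (greedy m \<omega> n) (\<omega> k))"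
    by (subst sum.swap) (intro sum.cong sum_gain_greedy[symmetric] refl)
  also have "\<dots> \<le> (\<Sum>\<omega>\<in>formulas n m. 4 * (real (max_sat (formula_of m \<omega>)) - 3 / 4 * real m))"
  proof (rule sum_mono)
    fix \<omega> assume "\<omega> \<in> formulas n m"
    have "X \<le> 4 * (M - y)" if "y + X / 4 \<le> M" for X M y :: real
      using that by simp
    from this[OF gain_le_max_sat[OF \<open>\<omega> \<in> _\<close>, of "greedy m \<omega> n", OF greedy_sign]]
    show "(\<Sum>k<m. gain (greedy m \<omega> n) (\<omega> k)) \<le> 4 * (real (max_sat (formula_of m \<omega>)) - 3 / 4 * real m)" .
  qed
  also have "\<dots> = 4 * ((\<Sum>\<omega>\<in>formulas n m. real (max_sat (formula_of m \<omega>))) - N * (3 / 4 * real m))"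
    by (simp add: sum_subtractf sum_distrib_left[symmetric] N_def)
  also have "\<dots> = N * (4 * (expected_max_sat n m - 3 / 4 * real m))"
    using N by (simp add: expected_max_sat_eq[OF n] N_def[symmetric] field_simps)
  finally have "r * S - 104 * real n \<le> 4 * (expected_max_sat n m - 3 / 4 * real m)"
    using N by simp
  moreover have "r * (sqrt w * (real n * (2 / 3 * (sqrt 8 - 1)) - 1)) \<le> r * S"
    using r S by (intro mult_left_mono)
  moreover have "r / 4 * X - 27 * real n \<le> E"
    if "r * S - 104 * real n \<le> 4 * E" "r * X \<le> r * S" for X E
    using that pos by simp
  ultimately show ?thesis unfolding w_def r_def by blast
qed

section \<open>From bounds at finite size to the asymptotic relation\<close>

lemma asymp_leI:
  fixes a b :: "nat \<Rightarrow> real"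
  assumes "\<forall>\<^sub>F n in sequentially. 0 < b n" "\<forall>\<^sub>F n in sequentially. a n \<le> b n"
  shows "a \<lesssim> b"
  unfolding asymp_le_def
proof
  have "\<forall>\<^sub>F n in sequentially. ereal (a n / b n) \<le> 1"
    using assms by eventually_elim (simp add: divide_le_eq)
  then show "limsup (\<lambda>n. ereal (a n / b n)) \<le> 1"
    by (rule Limsup_bounded)
qed (rule assms)

lemma lower_constant:
  "sqrt (2 / pi) / 4 * (sqrt 2 * (2 / 3 * (sqrt 8 - 1))) = (sqrt 8 - sqrt 1) / (3 * sqrt pi)"
proof -
  have "sqrt (2 / pi) * sqrt 2 = 2 / sqrt pi"
    by (simp add: real_sqrt_divide)
  moreover have "u / 4 * (v * B) = u * v / 4 * B" for u v B :: real by simp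
  ultimately have "sqrt (2 / pi) / 4 * (sqrt 2 * (2 / 3 * (sqrt 8 - 1))) = 2 / sqrt pi / 4 * (2 / 3 * (sqrt 8 - 1))"
    by metis
  also have "\<dots> = (sqrt 8 - sqrt 1) / (3 * sqrt pi)" by (simp add: divide_simps)
  finally show ?thesis .
qed

text \<open>Rounding \<open>c * n\<close> down and the Riemann sum error together cost at most
  \<open>3 * n\<close>, which with the earlier \<open>27 * n\<close> makes \<open>30 * n\<close>.
  The hypothesis \<open>c \<ge> 101\<close> keeps \<open>m \<ge> 100 * n\<close> after rounding, and
  \<open>n \<ge> c\<close> gives \<open>sqrt c \<le> n\<close>.\<close>

lemma expected_max_sat_ge_linear:
  fixes c :: real
  assumes c: "c \<ge> 101" and n: "n \<ge> 2" "real n \<ge> c"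
  shows "(sqrt c * ((sqrt 8 - sqrt 1) / (3 * sqrt pi)) - 30) * real n
    \<le> expected_max_sat n (nat \<lfloor>c * real n\<rfloor>) - 3 / 4 * real (nat \<lfloor>c * real n\<rfloor>)"
proof -
  define m where "m = nat \<lfloor>c * real n\<rfloor>"
  define \<kappa> where "\<kappa> = (sqrt 8 - sqrt 1) / (3 * sqrt pi)"
  define A where "A = 2 / 3 * (sqrt 8 - 1)"
  have m: "real m \<ge> c * real n - 1" unfolding m_def using c by linarith
  have m': "m \<ge> 100 * n"
  proof -
    have "c * real n \<ge> 101 * real n" using c by (intro mult_right_mono) auto
    then have "100 * real n \<le> real m" using m n(1) by linarith
    then show ?thesis by simp
  qed
  have "c \<le> real n * 1" using n by simp
  also have "\<dots> \<le> real n * real n" using n(1) by (intro mult_left_mono) auto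
  finally have "c \<le> (real n)\<^sup>2" by (simp add: power2_eq_square)
  then have sc: "1 \<le> sqrt c" "sqrt c \<le> real n" "sqrt c * sqrt c = c"
    using c by (auto intro: real_le_lsqrt)
  have A: "1 \<le> A" "A \<le> 2"
  proof -
    have "5/2 \<le> sqrt 8" by (rule real_le_rsqrt) (simp add: power2_eq_square)
    moreover have "sqrt 8 \<le> 3" by (rule real_le_lsqrt) auto
    ultimately show "1 \<le> A" "A \<le> 2" by (auto simp: A_def)
  qed
  \<comment> \<open>Rounding lowers \<open>m / n\<close> by at most \<open>1 / n \<le> 1\<close>,
    which the slack \<open>2 * sqrt c - 1\<close> in the square absorbs.\<close>
  have "(sqrt c - 1)\<^sup>2 \<le> real m / real n"
  proof -
    have "(sqrt c - 1)\<^sup>2 = c - 2 * sqrt c + 1" using sc by (simp add: power2_eq_square algebra_simps)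
    also have "\<dots> \<le> c - 1 / real n"
    proof -
      have "1 / real n \<le> 1" using n(1) by simp
      with sc(1) show ?thesis by linarith
    qed
    also have "\<dots> = (c * real n - 1) / real n" using n by (simp add: divide_simps)
    also have "\<dots> \<le> real m / real n" using m by (intro divide_right_mono) auto
    finally show ?thesis .
  qed
  then have "sqrt c - 1 \<le> sqrt (real m / real n)" by (rule real_le_rsqrt)
  then have "sqrt 2 * (sqrt c - 1) \<le> sqrt 2 * sqrt (real m / real n)" by (intro mult_left_mono) auto
  then have root: "sqrt 2 * (sqrt c - 1) \<le> sqrt (2 * real m / real n)"
    by (simp add: real_sqrt_mult[symmetric])
  have nA: "0 \<le> real n * A - 1"
    using mult_mono[of 1 "real n" 1 A] A n by simp
  have "sqrt (2 / pi) / 4 * (sqrt 2 * (sqrt c - 1) * (real n * A - 1))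
      \<le> sqrt (2 / pi) / 4 * (sqrt (2 * real m / real n) * (real n * A - 1))"
    by (rule mult_left_mono[OF mult_right_mono[OF root nA]]) simp
  also have "\<dots> \<le> expected_max_sat n m - 3 / 4 * real m + 27 * real n"
    using expected_max_sat_ge[OF n(1) m'] unfolding A_def by linarith
  finally have le: "sqrt (2 / pi) / 4 * (sqrt 2 * (sqrt c - 1) * (real n * A - 1))
      \<le> expected_max_sat n m - 3 / 4 * real m + 27 * real n" .
  define d where "d = sqrt (2 / pi) / 4 * sqrt 2"
  have d: "0 \<le> d" "d \<le> 1 / 2"
  proof -
    have "sqrt (2 / pi) \<le> 1" using pi_gt3 by simp
    then have "sqrt (2 / pi) * sqrt 2 \<le> 1 * 2" using sqrt2_less_2 by (intro mult_mono) auto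
    then show "d \<le> 1 / 2" by (simp add: d_def mult.commute)
  qed (simp add: d_def)
  have \<kappa>: "d * A = \<kappa>" using lower_constant by (simp add: d_def A_def \<kappa>_def)
  have "d * (A * real n + sqrt c) \<le> 1 / 2 * (2 * real n + real n)"
    using d A sc by (intro mult_mono add_mono) auto
  then have "\<kappa> * real n + d * sqrt c \<le> 3 * real n"
    using n by (simp add: \<kappa>[symmetric] algebra_simps)
  moreover have "sqrt (2 / pi) / 4 * (sqrt 2 * (sqrt c - 1) * (real n * A - 1))
      = sqrt c * \<kappa> * real n - (\<kappa> * real n + d * sqrt c) + d"
    unfolding \<kappa>[symmetric] d_def by (simp add: algebra_simps)
  ultimately show ?thesis
    using le d unfolding m_def[symmetric] \<kappa>_def[symmetric] by (simp add: algebra_simps)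
qed

theorem theorem4:
  shows "\<exists>g :: real \<Rightarrow> real. g \<in> O[at_top](\<lambda>_. 1) \<and>
    (\<forall>\<^sub>F c in at_top.
      (\<lambda>n. (sqrt c * ((sqrt 8 - sqrt 1) / (3 * sqrt pi)) - g c) * real n)
        \<lesssim> (\<lambda>n. expected_max_sat n (nat \<lfloor>c * real n\<rfloor>) - 3 / 4 * real (nat \<lfloor>c * real n\<rfloor>)) \<and>
      (\<lambda>n. expected_max_sat n (nat \<lfloor>c * real n\<rfloor>) - 3 / 4 * real (nat \<lfloor>c * real n\<rfloor>))
        \<lesssim> (\<lambda>n. sqrt c * sqrt (3 * ln 2 / 8) * real n))"
proof (intro exI[of _ "\<lambda>_. 30"] conjI)
  show "(\<lambda>_. 30 :: real) \<in> O[at_top](\<lambda>_. 1)" by simp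
  define \<kappa> where "\<kappa> = (sqrt 8 - sqrt 1) / (3 * sqrt pi)"
  have "\<kappa> > 0" by (simp add: \<kappa>_def)
  show "\<forall>\<^sub>F c in at_top.
      (\<lambda>n. (sqrt c * ((sqrt 8 - sqrt 1) / (3 * sqrt pi)) - 30) * real n)
        \<lesssim> (\<lambda>n. expected_max_sat n (nat \<lfloor>c * real n\<rfloor>) - 3 / 4 * real (nat \<lfloor>c * real n\<rfloor>)) \<and>
      (\<lambda>n. expected_max_sat n (nat \<lfloor>c * real n\<rfloor>) - 3 / 4 * real (nat \<lfloor>c * real n\<rfloor>))
        \<lesssim> (\<lambda>n. sqrt c * sqrt (3 * ln 2 / 8) * real n)"
    \<comment> \<open>Beyond the second threshold the lower bound is positive for all positive n, so
      the excess over \<open>3/4 m\<close> is eventually positive, as the first relation requires of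
      its right-hand side.\<close>
    using eventually_ge_at_top[of 101] eventually_gt_at_top[of "(30 / \<kappa>)\<^sup>2"]
  proof eventually_elim
    case (elim c)
    have "30 / \<kappa> < sqrt c" using elim by (intro real_less_rsqrt)
    then have pos: "0 < sqrt c * \<kappa> - 30" using \<open>\<kappa> > 0\<close> by (simp add: divide_simps)
    have large: "\<forall>\<^sub>F n in sequentially. n \<ge> 2 \<and> real n \<ge> c"
      using eventually_nat_real[OF eventually_ge_at_top[of c]] by (intro eventually_conj eventually_ge_at_top)
    show ?case
    proof (intro conjI asymp_leI)
      show lower: "\<forall>\<^sub>F n in sequentially. (sqrt c * ((sqrt 8 - sqrt 1) / (3 * sqrt pi)) - 30) * real n
          \<le> expected_max_sat n (nat \<lfloor>c * real n\<rfloor>) - 3 / 4 * real (nat \<lfloor>c * real n\<rfloor>)"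
        using large by eventually_elim (use elim in \<open>intro expected_max_sat_ge_linear, auto\<close>)
      show "\<forall>\<^sub>F n in sequentially. 0 < expected_max_sat n (nat \<lfloor>c * real n\<rfloor>) - 3 / 4 * real (nat \<lfloor>c * real n\<rfloor>)"
        using lower large
      proof eventually_elim
        case (elim n)
        have "0 < (sqrt c * \<kappa> - 30) * real n" using pos elim by (intro mult_pos_pos) auto
        then show ?case using elim unfolding \<kappa>_def by linarith
      qed
      show "\<forall>\<^sub>F n in sequentially. 0 < sqrt c * sqrt (3 * ln 2 / 8) * real n"
        using eventually_gt_at_top[of 0] by eventually_elim (use elim in simp)
      show "\<forall>\<^sub>F n in sequentially. expected_max_sat n (nat \<lfloor>c * real n\<rfloor>) - 3 / 4 * real (nat \<lfloor>c * real n\<rfloor>)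
          \<le> sqrt c * sqrt (3 * ln 2 / 8) * real n"
        using large
      proof eventually_elim
        case (elim n)
        define m where "m = nat \<lfloor>c * real n\<rfloor>"
        have "c * real n \<ge> 101 * 2" using \<open>101 \<le> c\<close> elim by (intro mult_mono) auto
        then have m: "m \<ge> 1" "real m \<le> c * real n"
          unfolding m_def by (auto intro!: le_nat_floor of_nat_floor)
        have "expected_max_sat n m - 3 / 4 * real m \<le> sqrt (3 * ln 2 / 8 * real n * real m)"
          using elim m by (intro expected_max_sat_le) auto
        also have "\<dots> \<le> sqrt (3 * ln 2 / 8 * real n * (c * real n))"
          using m by (intro real_sqrt_le_mono mult_left_mono) auto
        also have "\<dots> = sqrt (c * (3 * ln 2 / 8) * (real n)\<^sup>2)"
          by (simp add: power2_eq_square mult_ac)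
        also have "\<dots> = sqrt c * sqrt (3 * ln 2 / 8) * real n"
          unfolding real_sqrt_mult[of _ "(real n)\<^sup>2"] real_sqrt_mult[of c] by simp
        finally show ?case unfolding m_def .
      qed
    qed
  qed
qed

end
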